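(* Suppose $a\in(0,1)$ and $\lambda>0$, and suppose $X:=(X_k,\ k\in\mathbb{Z})$ is a strictly stationary INAR(1) process with Poisson innovations with parameters $a$ and $\lambda$ (as defined in the context). Then $X$ is $\rho^*$-mixing, i.e. $\rho^*(X,n)\to 0$ as $n\to\infty$; moreover $\rho^*(X,n)\to 0$ at least exponentially fast as $n\to\infty$, i.e. there exist constants $C>0$ and $r\in(0,1)$ such that $\rho^*(X,n)\le C r^n$ for all $n\ge 1$.
   Context: All random variables are defined on a probability space $(\Omega,\mathcal{F},P)$. $\overline{\mathbb{N}}:=\{0,1,2,\dots\}$. The notation $\sigma(\dots)$ means the $\sigma$-field generated by $(\dots)$, and $\mathcal{A}\vee\mathcal{B}$ is the $\sigma$-field generated by $\mathcal{A}\cup\mathcal{B}$. Maximal correlation: for $\sigma$-fields $\mathcal{A},\mathcal{B}\subset\mathcal{F}$, $\rho(\mathcal{A},\mathcal{B}):=\sup|\mathrm{Corr}(f,g)|$, where the supremum is over all pairs of square-integrable (real) random variables $f,g$ such that $f$ is $\mathcal{A}$-measurable and $g$ is $\mathcal{B}$-measurable (the correlation being interpreted as $0$ if $f$ or $g$ is a.s. constant). For a sequence $X=(X_k,\ k\in\mathbb{Z})$ and a positive integer $n$, $\rho^*(X,n):=\sup\rho(\sigma(X_k,k\in S),\sigma(X_k,k\in T))$, where the supremum is over all pairs of nonempty, disjoint sets $S,T\subset\mathbb{Z}$ such that $\mathrm{dist}(S,T):=\min_{s\in S,t\in T}|s-t|\ge n$ (the sets may be interlaced). A strictly stationary sequence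 $X$ is $\rho^*$-mixing if $\rho^*(X,n)\to0$ as $n\to\infty$. Markov triplet: an ordered triplet $(\mathcal{A},\mathcal{B},\mathcal{C})$ of $\sigma$-fields $\subset\mathcal{F}$ is a Markov triplet if for all $A\in\mathcal{A}$ and $C\in\mathcal{C}$, $P(A\cap C\mid\mathcal{B})=P(A\mid\mathcal{B})\,P(C\mid\mathcal{B})$ a.s. (equivalently, for all $C\in\mathcal{C}$, $P(C\mid\mathcal{A}\vee\mathcal{B})=P(C\mid\mathcal{B})$ a.s.; equivalently, for all $A\in\mathcal{A}$, $P(A\mid\mathcal{B}\vee\mathcal{C})=P(A\mid\mathcal{B})$ a.s.). INAR(1) process with Poisson innovations: for $a\in(0,1)$ and $\lambda>0$, a strictly stationary INAR(1) process with Poisson innovations (with parameters $a$ and $\lambda$) is a strictly stationary Markov chain $X:=(X_k,\ k\in\mathbb{Z})$ with state space $\overline{\mathbb{N}}$ such that there exist random variables $U_k,V_k$, $k\in\mathbb{Z}$, for which: (i) for each $k\in\mathbb{Z}$, $X_k=U_k+V_k$; (ii) for each $k\in\mathbb{Z}$ and each $x\in\overline{\mathbb{N}}$, the conditional distribution of $U_k$ given $\{X_{k-1}=x\}$ is binomial with parameters $x$ and $a$ (for $x=0$: the point mass at $0$); (iii) for each $k\in\mathbb{Z}$, $(\sigma(U_j,V_j,X_j,\ j\le k-1),\ \sigma(X_{k-1}),\ \sigma(U_k))$ is a Markov triplet; (iv) for each $k\in\mathbb{Z}$, the distribution of $V_k$ is Poisson with mean $\lambda$; (v) for each $k\in\mathbb{Z}$,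 $V_k$ is independent of the $\sigma$-field $\sigma(U_j,V_j,X_j,\ j\le k-1)\vee\sigma(U_k)$. *)

theory Defs
  imports "HOL-Probability.Probability"
begin

text \<open>
  As in \<^theory>\<open>HOL-Probability.Conditional_Expectation\<close>, a sub-\<open>\<sigma>\<close>-field of \<open>M\<close> is represented by
  a measure with the same space as \<open>M\<close> of which only the measurable sets matter.
\<close>

text \<open>
  The \<open>\<sigma>\<close>-field \<open>\<sigma>(Y k, k \<in> S)\<close>. The variables take values in a countable type carrying the
  discrete \<open>\<sigma>\<close>-field, so preimages of arbitrary sets of values are taken as generators.
\<close>
definition sigma_gen :: "'w measure \<Rightarrow> (int \<Rightarrow> 'w \<Rightarrow> 'b::countable) \<Rightarrow> int set \<Rightarrow> 'w measure" where
  "sigma_gen M Y S = sigma (space M) {Y k -` B \<inter> space M | k B. k \<in> S}"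

definition sigma_join :: "'w measure \<Rightarrow> 'w measure \<Rightarrow> 'w measure \<Rightarrow> 'w measure" where
  "sigma_join M A B = sigma (space M) (sets A \<union> sets B)"

text \<open>Since \<open>x / 0 = 0\<close>, this is \<open>0\<close> whenever \<open>f\<close> or \<open>g\<close> is almost surely constant.\<close>
definition corr :: "'w measure \<Rightarrow> ('w \<Rightarrow> real) \<Rightarrow> ('w \<Rightarrow> real) \<Rightarrow> real" where
  "corr M f g =
     (\<integral>\<omega>. (f \<omega> - (\<integral>x. f x \<partial>M)) * (g \<omega> - (\<integral>x. g x \<partial>M)) \<partial>M) /
     (sqrt (\<integral>\<omega>. (f \<omega> - (\<integral>x. f x \<partial>M))\<^sup>2 \<partial>M) * sqrt (\<integral>\<omega>. (g \<omega> - (\<integral>x. g x \<partial>M))\<^sup>2 \<partial>M))"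

definition square_integrable :: "'w measure \<Rightarrow> ('w \<Rightarrow> real) \<Rightarrow> bool" where
  "square_integrable M f \<longleftrightarrow> f \<in> borel_measurable M \<and> integrable M (\<lambda>\<omega>. (f \<omega>)\<^sup>2)"

text \<open>
  Over a probability space the suprema below are taken over nonempty sets of reals contained in
  \<open>{0..1}\<close>, by the Cauchy--Schwarz inequality, so the real-valued supremum is the genuine one.
\<close>
definition max_corr :: "'w measure \<Rightarrow> 'w measure \<Rightarrow> 'w measure \<Rightarrow> real" where
  "max_corr M A B = Sup {\<bar>corr M f g\<bar> | f g.
     f \<in> borel_measurable A \<and> square_integrable M f \<and>
     g \<in> borel_measurable B \<and> square_integrable M g}"

definition int_set_dist :: "int set \<Rightarrow> int set \<Rightarrow> nat" where
  "int_set_dist S T = Inf {nat \<bar>s - t\<bar> | s t. s \<in> S \<and> t \<in> T}"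

definition rho_star :: "'w measure \<Rightarrow> (int \<Rightarrow> 'w \<Rightarrow> 'b::countable) \<Rightarrow> nat \<Rightarrow> real" where
  "rho_star M X n = Sup {max_corr M (sigma_gen M X S) (sigma_gen M X T) | S T.
     S \<noteq> {} \<and> T \<noteq> {} \<and> S \<inter> T = {} \<and> n \<le> int_set_dist S T}"

definition rho_star_mixing :: "'w measure \<Rightarrow> (int \<Rightarrow> 'w \<Rightarrow> 'b::countable) \<Rightarrow> bool" where
  "rho_star_mixing M X \<longleftrightarrow> rho_star M X \<longlonglongrightarrow> 0"

text \<open>Equality of all finite-dimensional distributions under arbitrary time shifts.\<close>
definition strictly_stationary :: "'w measure \<Rightarrow> (int \<Rightarrow> 'w \<Rightarrow> 'b::countable) \<Rightarrow> bool" where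
  "strictly_stationary M X \<longleftrightarrow> (\<forall>J m. finite J \<longrightarrow>
     distr M (\<Pi>\<^sub>M k\<in>J. count_space UNIV) (\<lambda>\<omega>. \<lambda>k\<in>J. X (k + m) \<omega>) =
     distr M (\<Pi>\<^sub>M k\<in>J. count_space UNIV) (\<lambda>\<omega>. \<lambda>k\<in>J. X k \<omega>))"

definition markov_triplet :: "'w measure \<Rightarrow> 'w measure \<Rightarrow> 'w measure \<Rightarrow> 'w measure \<Rightarrow> bool" where
  "markov_triplet M A B C \<longleftrightarrow>
     subalgebra M A \<and> subalgebra M B \<and> subalgebra M C \<and>
     (\<forall>E\<in>sets A. \<forall>F\<in>sets C. AE \<omega> in M.
        real_cond_exp M B (indicator (E \<inter> F)) \<omega> =
        real_cond_exp M B (indicator E) \<omega> * real_cond_exp M B (indicator F) \<omega>)"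

definition markov_chain :: "'w measure \<Rightarrow> (int \<Rightarrow> 'w \<Rightarrow> 'b::countable) \<Rightarrow> bool" where
  "markov_chain M X \<longleftrightarrow>
     (\<forall>k. markov_triplet M (sigma_gen M X {..k - 1}) (sigma_gen M X {k - 1}) (sigma_gen M X {k}))"

text \<open>
  In the definition of the process, the \<open>\<sigma>\<close>-field generated by \<open>U j\<close>, \<open>V j\<close>, \<open>X j\<close> for \<open>j \<le> k - 1\<close>
  is the one generated by the triples \<open>(U j, V j, X j)\<close>, whose value type is again countable.
\<close>
definition INAR1_Poisson :: "'w measure \<Rightarrow> real \<Rightarrow> real \<Rightarrow> (int \<Rightarrow> 'w \<Rightarrow> nat) \<Rightarrow> bool" where
  "INAR1_Poisson M a l X \<longleftrightarrow>
     (\<forall>k. X k \<in> M \<rightarrow>\<^sub>M count_space UNIV) \<and> strictly_stationary M X \<and> markov_chain M X \<and>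
     (\<exists>U V :: int \<Rightarrow> 'w \<Rightarrow> nat.
        (\<forall>k. U k \<in> M \<rightarrow>\<^sub>M count_space UNIV \<and> V k \<in> M \<rightarrow>\<^sub>M count_space UNIV) \<and>
        (\<forall>k. \<forall>\<omega>\<in>space M. X k \<omega> = U k \<omega> + V k \<omega>) \<and>
        (\<forall>k x. 0 < measure M {\<omega>\<in>space M. X (k - 1) \<omega> = x} \<longrightarrow>
           distr (uniform_measure M {\<omega>\<in>space M. X (k - 1) \<omega> = x}) (count_space UNIV) (U k) =
             measure_pmf (binomial_pmf x a)) \<and>
        (\<forall>k. markov_triplet M
           (sigma_gen M (\<lambda>j \<omega>. (U j \<omega>, V j \<omega>, X j \<omega>)) {..k - 1})
           (sigma_gen M X {k - 1})
           (sigma_gen M U {k})) \<and>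
        (\<forall>k. distr M (count_space UNIV) (V k) = measure_pmf (poisson_pmf l)) \<and>
        (\<forall>k. prob_space.indep_set M
           (sets (sigma_gen M V {k}))
           (sets (sigma_join M
              (sigma_gen M (\<lambda>j \<omega>. (U j \<omega>, V j \<omega>, X j \<omega>)) {..k - 1})
              (sigma_gen M U {k})))))"

end

theory Submission
  imports Defs
begin

text \<open>
  The process counts individuals: \<open>X k\<close> is the number of those alive at time \<open>k\<close>, where
  individuals immigrate at rate \<open>l\<close> and survive each step with probability \<open>a\<close>. Their
  lifetimes, which are intervals \<open>I\<close> of integers, form a Poisson process with some intensity \<open>\<nu>\<close>.
  A function of \<open>(X k, k \<in> S)\<close> sees an individual only through \<open>I \<inter> S\<close>.

  The Poisson process enters only through the joint generating functions
  \<open>E (\<Prod>k. s k ^ X k) = exp (\<Sum>I. \<nu> I * ((\<Prod>k\<in>I. s k) - 1))\<close> over finite time windows. They follow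
  from the transition law and stationarity (\<open>window_pgf\<close>). Consequently, for the charges
  \<open>u\<^sub>s I = (\<Prod>k\<in>I. s k) - 1\<close>, the expected product of the power products for \<open>s\<close> and \<open>t\<close> is the
  product of their expectations times the exponential of the inner product of \<open>u\<^sub>s\<close> and \<open>u\<^sub>t\<close> with
  respect to \<open>\<nu>\<close>. Expanding this exponential decomposes covariances of linear combinations into
  powers of inner products (the chaos decomposition of a Poisson process). A
  bound for the first power holds with the same constant for all higher powers, hence for the
  whole covariance (\<open>exp_gram_contract\<close>).

  For the first power a bound on \<open>\<Sum>I. \<nu> I * f I * g I\<close> is needed, where \<open>f I\<close> depends on
  \<open>I \<inter> S\<close> and vanishes if this set is empty, and likewise \<open>g\<close> with \<open>T\<close>. If \<open>S\<close> and \<open>T\<close> have distance at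
  least \<open>n\<close>, then in an interval that meets both, all points of one of the two sets, say of \<open>T\<close>, come at
  least \<open>n\<close> steps after the start of the interval. Removing the first \<open>n\<close> points of the interval
  does not change \<open>g\<close>, but multiplies the weight by at least \<open>(1 - a) / a ^ n\<close>. So these intervals
  carry at most the share \<open>a ^ n / (1 - a)\<close> of the squared norm of \<open>g\<close>, and the Cauchy--Schwarz
  inequality gives the constant \<open>2 * sqrt (a ^ n / (1 - a))\<close>
  (\<open>interlaced_interval_contraction\<close>).

  Finally, linear combinations of power products over finite subsets of \<open>S\<close> are dense among the
  square-integrable functions measurable with respect to \<open>\<sigma>(X k, k \<in> S)\<close>
  (\<open>sigma_gen_L2_approximable\<close>), so the same constant bounds the maximal correlations.
\<close>

section \<open>Powers of a weighted inner product\<close>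

definition weighted_inner :: "'e set \<Rightarrow> ('e \<Rightarrow> real) \<Rightarrow> ('e \<Rightarrow> real) \<Rightarrow> ('e \<Rightarrow> real) \<Rightarrow> real" where
  "weighted_inner E w f g = (\<Sum>x\<in>E. w x * f x * g x)"

lemma sum_sqrt_mult_le:
  fixes a b :: "'i \<Rightarrow> real"
  assumes "\<And>i. i \<in> I \<Longrightarrow> 0 \<le> a i" "\<And>i. i \<in> I \<Longrightarrow> 0 \<le> b i"
  shows "(\<Sum>i\<in>I. sqrt (a i) * sqrt (b i)) \<le> sqrt (\<Sum>i\<in>I. a i) * sqrt (\<Sum>i\<in>I. b i)"
proof -
  have "(\<Sum>i\<in>I. sqrt (a i) * sqrt (b i)) = (\<Sum>i\<in>I. \<bar>sqrt (a i)\<bar> * \<bar>sqrt (b i)\<bar>)"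
    using assms by (intro sum.cong) auto
  also have "\<dots> \<le> L2_set (\<lambda>i. sqrt (a i)) I * L2_set (\<lambda>i. sqrt (b i)) I"
    by (rule L2_set_mult_ineq)
  also have "L2_set (\<lambda>i. sqrt (a i)) I = sqrt (\<Sum>i\<in>I. a i)"
    unfolding L2_set_def using assms by (intro arg_cong[where f = sqrt] sum.cong) auto
  also have "L2_set (\<lambda>i. sqrt (b i)) I = sqrt (\<Sum>i\<in>I. b i)"
    unfolding L2_set_def using assms by (intro arg_cong[where f = sqrt] sum.cong) auto
  finally show ?thesis .
qed

text \<open>
  The bilinear form in the coefficients \<open>c\<close>, \<open>d\<close> whose matrix consists of the \<open>n\<close>-th powers of
  inner products; equivalently, the inner product of \<open>\<Sum>i. c i u\<^sub>i\<^sup>\<otimes>\<^sup>n\<close> with \<open>\<Sum>j. d j v\<^sub>j\<^sup>\<otimes>\<^sup>n\<close>.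
\<close>
definition power_gram ::
  "'e set \<Rightarrow> ('e \<Rightarrow> real) \<Rightarrow> 'i set \<Rightarrow> ('i \<Rightarrow> 'e \<Rightarrow> real) \<Rightarrow> 'j set \<Rightarrow> ('j \<Rightarrow> 'e \<Rightarrow> real) \<Rightarrow>
     nat \<Rightarrow> ('i \<Rightarrow> real) \<Rightarrow> ('j \<Rightarrow> real) \<Rightarrow> real" where
  "power_gram E w I u J v n c d =
     (\<Sum>i\<in>I. \<Sum>j\<in>J. c i * d j * weighted_inner E w (u i) (v j) ^ n)"

lemma power_gram_0: "power_gram E w I u J v 0 c d = (\<Sum>i\<in>I. c i) * (\<Sum>j\<in>J. d j)"
  by (simp add: power_gram_def sum_product)

text \<open>
  Fixing the first tensor coordinate \<open>x\<close> lowers the power by one and multiplies the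
  coefficients by the values at \<open>x\<close>. This recursion replaces any use of tensor products.
\<close>
lemma power_gram_Suc:
  "power_gram E w I u J v (Suc n) c d =
     (\<Sum>x\<in>E. w x * power_gram E w I u J v n (\<lambda>i. c i * u i x) (\<lambda>j. d j * v j x))"
proof -
  have "power_gram E w I u J v (Suc n) c d =
    (\<Sum>i\<in>I. \<Sum>j\<in>J. \<Sum>x\<in>E. w x * (c i * u i x * (d j * v j x) * weighted_inner E w (u i) (v j) ^ n))"
    unfolding power_gram_def
    by (intro sum.cong refl)
       (simp add: weighted_inner_def sum_distrib_left sum_distrib_right algebra_simps)
  also have "\<dots> = (\<Sum>i\<in>I. \<Sum>x\<in>E. \<Sum>j\<in>J. w x * (c i * u i x * (d j * v j x) * weighted_inner E w (u i) (v j) ^ n))"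
    by (intro sum.cong refl sum.swap)
  also have "\<dots> = (\<Sum>x\<in>E. \<Sum>i\<in>I. \<Sum>j\<in>J. w x * (c i * u i x * (d j * v j x) * weighted_inner E w (u i) (v j) ^ n))"
    by (rule sum.swap)
  finally show ?thesis
    unfolding power_gram_def by (simp add: sum_distrib_left)
qed

lemma power_gram_nonneg:
  assumes w: "\<And>x. x \<in> E \<Longrightarrow> 0 \<le> w x"
  shows "0 \<le> power_gram E w I u I u n c c"
proof (induction n arbitrary: c)
  case 0
  then show ?case by (simp add: power_gram_0)
next
  case (Suc n)
  then show ?case by (simp add: power_gram_Suc sum_nonneg w)
qed

text \<open>
  A bound between single functions persists, with the same constant, when another tensor
  factor is added: for every frozen value of the extra coordinate the induction hypothesis applies,
  and the Cauchy--Schwarz inequality recombines the values.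
\<close>
lemma power_gram_contract:
  fixes u :: "'i \<Rightarrow> 'e \<Rightarrow> real" and v :: "'j \<Rightarrow> 'e \<Rightarrow> real"
  assumes w: "\<And>x. x \<in> E \<Longrightarrow> 0 \<le> w x" and \<kappa>: "0 \<le> \<kappa>"
    and base: "\<And>c d. \<bar>power_gram E w I u J v 1 c d\<bar> \<le>
      \<kappa> * (sqrt (power_gram E w I u I u 1 c c) * sqrt (power_gram E w J v J v 1 d d))"
  shows "\<bar>power_gram E w I u J v (Suc n) c d\<bar> \<le>
    \<kappa> * (sqrt (power_gram E w I u I u (Suc n) c c) * sqrt (power_gram E w J v J v (Suc n) d d))"
proof (induction n arbitrary: c d)
  case 0
  then show ?case using base by simp
next
  case (Suc n)
  let ?A = "\<lambda>x. power_gram E w I u I u (Suc n) (\<lambda>i. c i * u i x) (\<lambda>i. c i * u i x)"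
  let ?B = "\<lambda>x. power_gram E w J v J v (Suc n) (\<lambda>j. d j * v j x) (\<lambda>j. d j * v j x)"
  have nn: "0 \<le> ?A x" "0 \<le> ?B x" for x
    by (rule power_gram_nonneg, rule w, assumption)+
  have "\<bar>power_gram E w I u J v (Suc (Suc n)) c d\<bar> \<le>
    (\<Sum>x\<in>E. w x * \<bar>power_gram E w I u J v (Suc n) (\<lambda>i. c i * u i x) (\<lambda>j. d j * v j x)\<bar>)"
    unfolding power_gram_Suc[of _ _ _ _ _ _ "Suc n"]
    by (rule order_trans[OF sum_abs]) (auto intro!: sum_mono simp: abs_mult w)
  also have "\<dots> \<le> (\<Sum>x\<in>E. w x * (\<kappa> * (sqrt (?A x) * sqrt (?B x))))"
    by (intro sum_mono mult_left_mono Suc.IH w)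
  also have "\<dots> = \<kappa> * (\<Sum>x\<in>E. sqrt (w x * ?A x) * sqrt (w x * ?B x))"
    unfolding sum_distrib_left
  proof (intro sum.cong refl)
    fix x assume "x \<in> E"
    then have "sqrt (w x * ?A x) * sqrt (w x * ?B x) = (sqrt (w x) * sqrt (w x)) * (sqrt (?A x) * sqrt (?B x))"
      by (simp only: real_sqrt_mult mult_ac)
    also have "sqrt (w x) * sqrt (w x) = w x" using w \<open>x \<in> E\<close> by simp
    finally show "w x * (\<kappa> * (sqrt (?A x) * sqrt (?B x))) = \<kappa> * (sqrt (w x * ?A x) * sqrt (w x * ?B x))"
      by simp
  qed
  also have "\<dots> \<le> \<kappa> * (sqrt (\<Sum>x\<in>E. w x * ?A x) * sqrt (\<Sum>x\<in>E. w x * ?B x))"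
    by (intro mult_left_mono sum_sqrt_mult_le \<kappa> mult_nonneg_nonneg w nn)
  finally show ?case
    unfolding power_gram_Suc[of _ _ _ _ _ _ "Suc n"] .
qed

lemma power_gram_exp_sums:
  "(\<lambda>n. power_gram E w I u J v (Suc n) c d / fact (Suc n)) sums
     (\<Sum>i\<in>I. \<Sum>j\<in>J. c i * d j * (exp (weighted_inner E w (u i) (v j)) - 1))"
proof -
  have e: "(\<lambda>n. x ^ Suc n / fact (Suc n)) sums (exp x - 1)" for x :: real
    using exp_converges[of x] by (subst sums_Suc_iff) (simp add: divide_inverse mult.commute)
  have "(\<lambda>n. \<Sum>i\<in>I. \<Sum>j\<in>J. c i * d j * (weighted_inner E w (u i) (v j) ^ Suc n / fact (Suc n))) sums
     (\<Sum>i\<in>I. \<Sum>j\<in>J. c i * d j * (exp (weighted_inner E w (u i) (v j)) - 1))"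
    by (intro sums_sum sums_mult e)
  then show ?thesis
    by (simp only: power_gram_def sum_divide_distrib times_divide_eq_right)
qed

text \<open>
  Expanding \<open>exp - 1\<close> turns the three forms into sums of the power forms over \<open>n \<ge> 1\<close> with the
  positive weights \<open>1 / n!\<close>. Each summand satisfies the bound, so their sums do, again by the
  Cauchy--Schwarz inequality. Subtracting \<open>1\<close> removes the term for \<open>n = 0\<close>, which stands for the
  product of the means; so the three forms can be read as a covariance and two variances.
\<close>
lemma exp_gram_contract:
  fixes u :: "'i \<Rightarrow> 'e \<Rightarrow> real" and v :: "'j \<Rightarrow> 'e \<Rightarrow> real"
  assumes w: "\<And>x. x \<in> E \<Longrightarrow> 0 \<le> w x" and \<kappa>: "0 \<le> \<kappa>"
    and base: "\<And>c d. \<bar>power_gram E w I u J v 1 c d\<bar> \<le>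
      \<kappa> * (sqrt (power_gram E w I u I u 1 c c) * sqrt (power_gram E w J v J v 1 d d))"
  shows "\<bar>\<Sum>i\<in>I. \<Sum>j\<in>J. c i * d j * (exp (weighted_inner E w (u i) (v j)) - 1)\<bar> \<le>
    \<kappa> * (sqrt (\<Sum>i\<in>I. \<Sum>j\<in>I. c i * c j * (exp (weighted_inner E w (u i) (u j)) - 1)) *
         sqrt (\<Sum>i\<in>J. \<Sum>j\<in>J. d i * d j * (exp (weighted_inner E w (v i) (v j)) - 1)))"
proof (rule LIMSEQ_le)
  let ?x = "\<lambda>n. power_gram E w I u J v (Suc n) c d / fact (Suc n)"
  let ?A = "\<lambda>n. power_gram E w I u I u (Suc n) c c / fact (Suc n)"
  let ?B = "\<lambda>n. power_gram E w J v J v (Suc n) d d / fact (Suc n)"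
  have nn: "0 \<le> ?A n" "0 \<le> ?B n" for n
    using power_gram_nonneg[OF w] by (auto intro!: divide_nonneg_nonneg)
  show "(\<lambda>N. \<bar>\<Sum>n<N. ?x n\<bar>) \<longlonglongrightarrow>
      \<bar>\<Sum>i\<in>I. \<Sum>j\<in>J. c i * d j * (exp (weighted_inner E w (u i) (v j)) - 1)\<bar>"
    by (intro tendsto_rabs power_gram_exp_sums[unfolded sums_def])
  show "(\<lambda>N. \<kappa> * (sqrt (\<Sum>n<N. ?A n) * sqrt (\<Sum>n<N. ?B n))) \<longlonglongrightarrow>
    \<kappa> * (sqrt (\<Sum>i\<in>I. \<Sum>j\<in>I. c i * c j * (exp (weighted_inner E w (u i) (u j)) - 1)) *
         sqrt (\<Sum>i\<in>J. \<Sum>j\<in>J. d i * d j * (exp (weighted_inner E w (v i) (v j)) - 1)))"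
    by (intro tendsto_mult tendsto_const tendsto_real_sqrt power_gram_exp_sums[unfolded sums_def])
  have "\<bar>\<Sum>n<N. ?x n\<bar> \<le> \<kappa> * (sqrt (\<Sum>n<N. ?A n) * sqrt (\<Sum>n<N. ?B n))" for N
  proof -
    have "\<bar>\<Sum>n<N. ?x n\<bar> \<le> (\<Sum>n<N. \<bar>?x n\<bar>)" by (rule sum_abs)
    also have "\<dots> \<le> (\<Sum>n<N. \<kappa> * (sqrt (?A n) * sqrt (?B n)))"
    proof (rule sum_mono)
      fix n
      define r where "r = sqrt (fact (Suc n) :: real)"
      have r: "fact (Suc n) = r * r" by (simp add: r_def)
      have "\<bar>?x n\<bar> = \<bar>power_gram E w I u J v (Suc n) c d\<bar> / fact (Suc n)" by (simp add: abs_divide)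
      also have "\<dots> \<le> (\<kappa> * (sqrt (power_gram E w I u I u (Suc n) c c) * sqrt (power_gram E w J v J v (Suc n) d d))) / fact (Suc n)"
        by (intro divide_right_mono power_gram_contract[OF w \<kappa> base]) auto
      also have "\<dots> = \<kappa> * (sqrt (?A n) * sqrt (?B n))"
        unfolding real_sqrt_divide r_def[symmetric] unfolding r by simp
      finally show "\<bar>?x n\<bar> \<le> \<kappa> * (sqrt (?A n) * sqrt (?B n))" .
    qed
    also have "\<dots> = \<kappa> * (\<Sum>n<N. sqrt (?A n) * sqrt (?B n))" by (simp only: sum_distrib_left)
    also have "\<dots> \<le> \<kappa> * (sqrt (\<Sum>n<N. ?A n) * sqrt (\<Sum>n<N. ?B n))"
      by (intro mult_left_mono \<kappa> sum_sqrt_mult_le nn)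
    finally show ?thesis .
  qed
  then show "\<exists>N. \<forall>n\<ge>N. \<bar>\<Sum>n<n. ?x n\<bar> \<le> \<kappa> * (sqrt (\<Sum>k<n. ?A k) * sqrt (\<Sum>k<n. ?B k))" by blast
qed

section \<open>Lifetimes in a time window\<close>

definition window_intervals :: "int \<Rightarrow> int \<Rightarrow> (int \<times> int) set" where
  "window_intervals p q = {(b, e). p \<le> b \<and> b \<le> e \<and> e \<le> q}"

text \<open>
  The intensity of individuals that are alive in the window \<open>{p..q}\<close> exactly during \<open>{b..e}\<close>.
  For \<open>b = p\<close> it counts everybody alive at time \<open>p\<close>, with mean \<open>l / (1 - a)\<close>, and for \<open>e = q\<close> the
  individual need not die after \<open>e\<close>, so there is no factor \<open>1 - a\<close>.
\<close>
definition interval_weight :: "real \<Rightarrow> real \<Rightarrow> int \<Rightarrow> int \<Rightarrow> int \<times> int \<Rightarrow> real" where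
  "interval_weight a l p q = (\<lambda>(b, e).
     (if b = p then l / (1 - a) else l) * a ^ nat (e - b) * (if e = q then 1 else 1 - a))"

lemma finite_window_intervals: "finite (window_intervals p q)"
  by (rule finite_subset[of _ "{p..q} \<times> {p..q}"]) (auto simp: window_intervals_def)

lemma interval_weight_nonneg:
  assumes "0 < a" "a < 1" "0 < l" shows "0 \<le> interval_weight a l p q I"
  using assms by (auto simp: interval_weight_def split: prod.split)

text \<open>
  If every point of \<open>T\<close> in \<open>{b..e}\<close> comes at least \<open>d\<close> steps after \<open>b\<close>, then \<open>{b + d..e}\<close> contains
  the same points of \<open>T\<close>, and its weight is larger by a factor of at least \<open>(1 - a) / a ^ d\<close>. As
  the shift is injective, such intervals carry only a small share of the norm of \<open>g\<close>. The
  factor \<open>1 / (1 - a)\<close> pays for intervals that start at the left edge of the window.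
\<close>
lemma shifted_start_mass:
  assumes a: "0 < a" "a < 1" and l: "0 < l" and d: "1 \<le> d"
    and sub: "D \<subseteq> window_intervals p q"
    and D: "\<And>b e. (b, e) \<in> D \<Longrightarrow> T \<inter> {b..e} \<noteq> {}"
      "\<And>b e t. (b, e) \<in> D \<Longrightarrow> t \<in> T \<Longrightarrow> t \<in> {b..e} \<Longrightarrow> b + int d \<le> t"
    and g: "\<And>b b' e. T \<inter> {b..e} = T \<inter> {b'..e} \<Longrightarrow> g (b, e) = g (b', e)"
  shows "(\<Sum>I\<in>D. interval_weight a l p q I * (g I)\<^sup>2) \<le>
    a ^ d / (1 - a) * (\<Sum>I\<in>window_intervals p q. interval_weight a l p q I * (g I)\<^sup>2)"
proof -
  let ?w = "interval_weight a l p q"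
  let ?sh = "\<lambda>(b, e). (b + int d, e)"
  have "(\<Sum>I\<in>D. ?w I * (g I)\<^sup>2) \<le> (\<Sum>I\<in>D. a ^ d / (1 - a) * (?w (?sh I) * (g (?sh I))\<^sup>2))"
  proof (rule sum_mono)
    fix I assume "I \<in> D"
    obtain b e where I: "I = (b, e)" by force
    obtain t where t: "t \<in> T" "t \<in> {b..e}" using D(1) \<open>I \<in> D\<close> I by blast
    have le: "b + int d \<le> e" using D(2)[of b e t] t \<open>I \<in> D\<close> I by auto
    have pb: "p \<le> b" using sub \<open>I \<in> D\<close> I by (auto simp: window_intervals_def)
    have "T \<inter> {b..e} = T \<inter> {b + int d..e}"
      using D(2)[of b e] \<open>I \<in> D\<close> I by auto
    from g[OF this] have g': "g I = g (?sh I)" by (simp add: I)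
    have nat: "nat (e - b) = d + nat (e - (b + int d))" using le by linarith
    have "?w I \<le> a ^ d / (1 - a) * ?w (?sh I)"
    proof -
      have "(if b = p then l / (1 - a) else l) \<le> l / (1 - a)"
        using a l by (auto simp: field_simps)
      then have "?w I \<le> l / (1 - a) * a ^ nat (e - b) * (if e = q then 1 else 1 - a)"
        using a unfolding interval_weight_def I prod.case by (intro mult_right_mono) auto
      also have "\<dots> = a ^ d / (1 - a) * ?w (?sh I)"
        using pb d unfolding nat power_add by (simp add: interval_weight_def I)
      finally show ?thesis .
    qed
    then show "?w I * (g I)\<^sup>2 \<le> a ^ d / (1 - a) * (?w (?sh I) * (g (?sh I))\<^sup>2)"
      unfolding g' mult.assoc[symmetric] by (intro mult_right_mono) auto
  qed
  also have "\<dots> = a ^ d / (1 - a) * (\<Sum>I\<in>?sh ` D. ?w I * (g I)\<^sup>2)"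
    by (subst sum.reindex) (auto simp: inj_on_def sum_distrib_left)
  also have "\<dots> \<le> a ^ d / (1 - a) * (\<Sum>I\<in>window_intervals p q. ?w I * (g I)\<^sup>2)"
  proof (intro mult_left_mono sum_mono2 finite_window_intervals)
    show "?sh ` D \<subseteq> window_intervals p q"
    proof (safe)
      fix b e assume "(b, e) \<in> D"
      moreover obtain t where t: "t \<in> T" "t \<in> {b..e}" using D(1) calculation by blast
      ultimately show "(b + int d, e) \<in> window_intervals p q"
        using D(2)[of b e t] sub by (force simp: window_intervals_def)
    qed
    show "0 \<le> a ^ d / (1 - a)" using a by simp
  qed (use interval_weight_nonneg[OF a l] in \<open>auto intro!: mult_nonneg_nonneg\<close>)
  finally show ?thesis .
qed

text \<open>
  An interval that contributes to the sum meets both \<open>S\<close> and \<open>T\<close>. It cannot contain points of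
  both sets within distance less than \<open>d\<close> of its start, since these would be too close to each
  other; hence the preceding lemma applies to \<open>f\<close> or to \<open>g\<close>. Only the left ends of the
  intervals matter, so the interlacing of \<open>S\<close> and \<open>T\<close> is harmless.
\<close>
lemma interlaced_interval_contraction:
  assumes a: "0 < a" "a < 1" and l: "0 < l" and d: "1 \<le> d"
    and dist: "\<And>s t. s \<in> S \<Longrightarrow> t \<in> T \<Longrightarrow> int d \<le> \<bar>s - t\<bar>"
    and f: "\<And>b b' e. S \<inter> {b..e} = S \<inter> {b'..e} \<Longrightarrow> f (b, e) = f (b', e)"
      "\<And>b e. S \<inter> {b..e} = {} \<Longrightarrow> f (b, e) = 0"
    and g: "\<And>b b' e. T \<inter> {b..e} = T \<inter> {b'..e} \<Longrightarrow> g (b, e) = g (b', e)"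
      "\<And>b e. T \<inter> {b..e} = {} \<Longrightarrow> g (b, e) = 0"
  shows "\<bar>\<Sum>I\<in>window_intervals p q. interval_weight a l p q I * f I * g I\<bar> \<le>
    2 * sqrt (a ^ d / (1 - a)) *
    (sqrt (\<Sum>I\<in>window_intervals p q. interval_weight a l p q I * (f I)\<^sup>2) *
     sqrt (\<Sum>I\<in>window_intervals p q. interval_weight a l p q I * (g I)\<^sup>2))"
proof -
  let ?w = "interval_weight a l p q" and ?W = "window_intervals p q"
  note wnn = interval_weight_nonneg[OF a l, of p q]
  \<comment> \<open>the intervals whose points in \<open>R\<close> survive the removal of the first \<open>d\<close> points\<close>
  define late where "late R = {(b, e) \<in> ?W. R \<inter> {b..e} \<noteq> {} \<and> (\<forall>t\<in>R \<inter> {b..e}. b + int d \<le> t)}" for R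
  have fin: "finite ?W" by (rule finite_window_intervals)
  have sub: "late R \<subseteq> ?W" for R by (auto simp: late_def)
  have finl: "finite (late R)" for R using sub fin by (rule finite_subset)
  have cover: "?w I * \<bar>f I\<bar> * \<bar>g I\<bar> = 0" if "I \<in> ?W - (late S \<union> late T)" for I
  proof -
    obtain b e where I: "I = (b, e)" by force
    consider "S \<inter> {b..e} = {}" | "T \<inter> {b..e} = {}"
      | s t where "s \<in> S" "t \<in> T" "s \<in> {b..e}" "t \<in> {b..e}" "s < b + int d" "t < b + int d"
    proof (cases "S \<inter> {b..e} = {} \<or> T \<inter> {b..e} = {}")
      case True
      then show ?thesis using that by blast
    next
      case False
      have "(b, e) \<notin> late S" "(b, e) \<notin> late T" "(b, e) \<in> ?W"
        using that(2-) \<open>I \<in> _\<close> unfolding I by auto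
      then have "\<exists>s\<in>S \<inter> {b..e}. \<not> b + int d \<le> s" "\<exists>t\<in>T \<inter> {b..e}. \<not> b + int d \<le> t"
        using False by (auto simp: late_def)
      then show ?thesis using that(3) by fastforce
    qed
    then show ?thesis
    proof cases
      case 3
      then show ?thesis using dist[of s t] by auto
    next
      case 1
      then show ?thesis using f(2)[of b e] by (simp add: I)
    next
      case 2
      then show ?thesis using g(2)[of b e] by (simp add: I)
    qed
  qed
  have cs: "(\<Sum>I\<in>D. ?w I * \<bar>h I\<bar> * \<bar>k I\<bar>) \<le>
      sqrt (\<Sum>I\<in>?W. ?w I * (h I)\<^sup>2) * sqrt (\<Sum>I\<in>D. ?w I * (k I)\<^sup>2)"
    if "D \<subseteq> ?W" for D h k
  proof -
    have "(\<Sum>I\<in>D. ?w I * \<bar>h I\<bar> * \<bar>k I\<bar>) = (\<Sum>I\<in>D. sqrt (?w I * (h I)\<^sup>2) * sqrt (?w I * (k I)\<^sup>2))"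
    proof (intro sum.cong refl)
      fix I
      have "sqrt (?w I * (h I)\<^sup>2) * sqrt (?w I * (k I)\<^sup>2) = (sqrt (?w I) * sqrt (?w I)) * (\<bar>h I\<bar> * \<bar>k I\<bar>)"
        by (simp only: real_sqrt_mult real_sqrt_abs mult_ac)
      then show "?w I * \<bar>h I\<bar> * \<bar>k I\<bar> = sqrt (?w I * (h I)\<^sup>2) * sqrt (?w I * (k I)\<^sup>2)"
        using wnn by simp
    qed
    also have "\<dots> \<le> sqrt (\<Sum>I\<in>D. ?w I * (h I)\<^sup>2) * sqrt (\<Sum>I\<in>D. ?w I * (k I)\<^sup>2)"
      by (intro sum_sqrt_mult_le mult_nonneg_nonneg wnn) auto
    also have "\<dots> \<le> sqrt (\<Sum>I\<in>?W. ?w I * (h I)\<^sup>2) * sqrt (\<Sum>I\<in>D. ?w I * (k I)\<^sup>2)"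
      by (intro mult_right_mono real_sqrt_le_mono sum_mono2 fin that)
         (auto intro!: mult_nonneg_nonneg wnn sum_nonneg)
    finally show ?thesis .
  qed
  have half: "(\<Sum>I\<in>late R. ?w I * \<bar>h I\<bar> * \<bar>k I\<bar>) \<le>
      sqrt (a ^ d / (1 - a)) * (sqrt (\<Sum>I\<in>?W. ?w I * (h I)\<^sup>2) * sqrt (\<Sum>I\<in>?W. ?w I * (k I)\<^sup>2))"
    if "\<And>b b' e. R \<inter> {b..e} = R \<inter> {b'..e} \<Longrightarrow> k (b, e) = k (b', e)" for R h k
  proof -
    have "(\<Sum>I\<in>late R. ?w I * (k I)\<^sup>2) \<le> a ^ d / (1 - a) * (\<Sum>I\<in>?W. ?w I * (k I)\<^sup>2)"
      by (rule shifted_start_mass[OF a l d sub, of R], auto simp: late_def) (rule that)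
    from real_sqrt_le_mono[OF this]
    have "sqrt (\<Sum>I\<in>late R. ?w I * (k I)\<^sup>2) \<le> sqrt (a ^ d / (1 - a)) * sqrt (\<Sum>I\<in>?W. ?w I * (k I)\<^sup>2)"
      by (simp only: real_sqrt_mult)
    then have "sqrt (\<Sum>I\<in>?W. ?w I * (h I)\<^sup>2) * sqrt (\<Sum>I\<in>late R. ?w I * (k I)\<^sup>2) \<le>
      sqrt (\<Sum>I\<in>?W. ?w I * (h I)\<^sup>2) * (sqrt (a ^ d / (1 - a)) * sqrt (\<Sum>I\<in>?W. ?w I * (k I)\<^sup>2))"
      by (intro mult_left_mono) (auto intro!: sum_nonneg mult_nonneg_nonneg wnn)
    with cs[of "late R" h k, OF sub]
    have "(\<Sum>I\<in>late R. ?w I * \<bar>h I\<bar> * \<bar>k I\<bar>) \<le>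
      sqrt (\<Sum>I\<in>?W. ?w I * (h I)\<^sup>2) * (sqrt (a ^ d / (1 - a)) * sqrt (\<Sum>I\<in>?W. ?w I * (k I)\<^sup>2))"
      by (rule order_trans)
    then show ?thesis by (simp only: mult_ac)
  qed
  have "\<bar>\<Sum>I\<in>?W. ?w I * f I * g I\<bar> \<le> (\<Sum>I\<in>?W. ?w I * \<bar>f I\<bar> * \<bar>g I\<bar>)"
    by (rule order_trans[OF sum_abs]) (auto intro!: sum_mono simp: abs_mult wnn)
  also have "\<dots> = (\<Sum>I\<in>late S \<union> late T. ?w I * \<bar>f I\<bar> * \<bar>g I\<bar>)"
    by (intro sum.mono_neutral_right fin) (use sub in blast, use cover in blast)
  also have "\<dots> \<le> (\<Sum>I\<in>late S. ?w I * \<bar>f I\<bar> * \<bar>g I\<bar>) + (\<Sum>I\<in>late T. ?w I * \<bar>f I\<bar> * \<bar>g I\<bar>)"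
    by (subst sum_Un[OF finl finl]) (auto intro!: sum_nonneg mult_nonneg_nonneg wnn)
  also have "(\<Sum>I\<in>late S. ?w I * \<bar>f I\<bar> * \<bar>g I\<bar>) = (\<Sum>I\<in>late S. ?w I * \<bar>g I\<bar> * \<bar>f I\<bar>)"
    by (simp only: mult_ac)
  also have "\<dots> + (\<Sum>I\<in>late T. ?w I * \<bar>f I\<bar> * \<bar>g I\<bar>) \<le>
    sqrt (a ^ d / (1 - a)) * (sqrt (\<Sum>I\<in>?W. ?w I * (g I)\<^sup>2) * sqrt (\<Sum>I\<in>?W. ?w I * (f I)\<^sup>2)) +
    sqrt (a ^ d / (1 - a)) * (sqrt (\<Sum>I\<in>?W. ?w I * (f I)\<^sup>2) * sqrt (\<Sum>I\<in>?W. ?w I * (g I)\<^sup>2))"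
    by (intro add_mono half f(1) g(1))
  finally show ?thesis by (simp add: mult_ac)
qed

definition interval_charge :: "(int \<Rightarrow> real) \<Rightarrow> int \<times> int \<Rightarrow> real" where
  "interval_charge s = (\<lambda>(b, e). (\<Prod>k\<in>{b..e}. s k) - 1)"

text \<open>
  The logarithm of the joint generating function of the numbers of individuals alive at the times
  of the window, for a Poisson process of lifetimes with the above intensity.
\<close>
definition log_pgf :: "real \<Rightarrow> real \<Rightarrow> int \<Rightarrow> int \<Rightarrow> (int \<Rightarrow> real) \<Rightarrow> real" where
  "log_pgf a l p q s =
     (\<Sum>(b, e)\<in>window_intervals p q. interval_weight a l p q (b, e) * ((\<Prod>k\<in>{b..e}. s k) - 1))"

lemma log_pgf_single: "log_pgf a l p p s = l / (1 - a) * (s p - 1)"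
proof -
  have "window_intervals p p = {(p, p)}" by (auto simp: window_intervals_def)
  then show ?thesis by (simp add: log_pgf_def interval_weight_def)
qed

lemma log_pgf_nested:
  "log_pgf a l p q s =
     (\<Sum>e\<in>{p..q}. \<Sum>b\<in>{p..e}. interval_weight a l p q (b, e) * ((\<Prod>k\<in>{b..e}. s k) - 1))"
proof -
  have "window_intervals p q = (\<lambda>(e, b). (b, e)) ` (SIGMA e:{p..q}. {p..e})"
    by (force simp: window_intervals_def)
  then show ?thesis
    unfolding log_pgf_def
    by (simp add: sum.reindex inj_on_def case_prod_unfold sum.Sigma)
qed

text \<open>
  Appending time \<open>q + 1\<close> lets an individual alive at time \<open>q\<close> either die, with probability
  \<open>1 - a\<close>, or survive and contribute the factor \<open>s (q + 1)\<close>, and it adds the immigrants of time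
  \<open>q + 1\<close>. The same recursion governs the process.
\<close>
lemma log_pgf_extend:
  assumes "p \<le> q"
  shows "log_pgf a l p (q + 1) s =
    l * (s (q + 1) - 1) + log_pgf a l p q (s(q := s q * (1 - a + a * s (q + 1))))"
proof -
  let ?s' = "s(q := s q * (1 - a + a * s (q + 1)))"
  let ?h = "\<lambda>q s e b. interval_weight a l p q (b, e) * ((\<Prod>k\<in>{b..e}. s k) - 1)"
  let ?\<beta> = "\<lambda>b. (if b = p then l / (1 - a) else l) * a ^ nat (q - b)"
  have s1: "{p..q + 1} = insert (q + 1) (insert q {p..q - 1})" and s2: "{p..q} = insert q {p..q - 1}"
    using assms by auto
  have lhs: "log_pgf a l p (q + 1) s =
     (\<Sum>b\<in>{p..q + 1}. ?h (q + 1) s (q + 1) b) + ((\<Sum>b\<in>{p..q}. ?h (q + 1) s q b) + (\<Sum>e\<in>{p..q - 1}. \<Sum>b\<in>{p..e}. ?h (q + 1) s e b))"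
    unfolding log_pgf_nested by (subst (1) s1) simp
  have rhs: "log_pgf a l p q ?s' = (\<Sum>b\<in>{p..q}. ?h q ?s' q b) + (\<Sum>e\<in>{p..q - 1}. \<Sum>b\<in>{p..e}. ?h q ?s' e b)"
    unfolding log_pgf_nested by (subst (1) s2) simp
  have eq1: "(\<Sum>e\<in>{p..q - 1}. \<Sum>b\<in>{p..e}. ?h (q + 1) s e b) = (\<Sum>e\<in>{p..q - 1}. \<Sum>b\<in>{p..e}. ?h q ?s' e b)"
  proof (intro sum.cong refl)
    fix e b assume "e \<in> {p..q - 1}"
    then have "(\<Prod>k\<in>{b..e}. s k) = (\<Prod>k\<in>{b..e}. ?s' k)" by (intro prod.cong) auto
    with \<open>e \<in> _\<close> show "?h (q + 1) s e b = ?h q ?s' e b" by (simp add: interval_weight_def)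
  qed
  have s3: "{p..q + 1} = insert (q + 1) {p..q}" using assms by auto
  have eq2: "(\<Sum>b\<in>{p..q + 1}. ?h (q + 1) s (q + 1) b) = l * (s (q + 1) - 1) + (\<Sum>b\<in>{p..q}. ?h (q + 1) s (q + 1) b)"
    unfolding s3 using assms by (subst sum.insert) (auto simp: interval_weight_def)
  have eq3: "(\<Sum>b\<in>{p..q}. ?h (q + 1) s (q + 1) b) + (\<Sum>b\<in>{p..q}. ?h (q + 1) s q b) = (\<Sum>b\<in>{p..q}. ?h q ?s' q b)"
    unfolding sum.distrib[symmetric]
  proof (intro sum.cong refl)
    fix b assume b: "b \<in> {p..q}"
    define P where "P = (\<Prod>k\<in>{b..q}. s k)"
    have bq: "{b..q} = insert q {b..q - 1}" "{b..q + 1} = insert (q + 1) {b..q}" using b by auto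
    have P1: "(\<Prod>k\<in>{b..q + 1}. s k) = P * s (q + 1)"
      unfolding bq(2) P_def by simp
    have "(\<Prod>k\<in>{b..q - 1}. ?s' k) = (\<Prod>k\<in>{b..q - 1}. s k)" by (intro prod.cong) auto
    then have P2: "(\<Prod>k\<in>{b..q}. ?s' k) = P * (1 - a + a * s (q + 1))"
      unfolding P_def bq(1) by simp
    have n: "nat (q + 1 - b) = Suc (nat (q - b))" using b by auto
    have w: "interval_weight a l p (q + 1) (b, q + 1) = ?\<beta> b * a"
      "interval_weight a l p (q + 1) (b, q) = ?\<beta> b * (1 - a)" "interval_weight a l p q (b, q) = ?\<beta> b"
      unfolding interval_weight_def by (simp_all add: n)
    show "?h (q + 1) s (q + 1) b + ?h (q + 1) s q b = ?h q ?s' q b"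
      unfolding w P1 P2 P_def[symmetric] by (simp only: algebra_simps)
  qed
  show ?thesis unfolding lhs rhs using eq1 eq2 eq3 by linarith
qed

text \<open>
  From \<open>x y - 1 = (x - 1) + (y - 1) + (x - 1) (y - 1)\<close>. This is where covariances of power
  products become inner products of charges.
\<close>
lemma log_pgf_mult:
  "log_pgf a l p q (\<lambda>k. s k * t k) = log_pgf a l p q s + log_pgf a l p q t +
     weighted_inner (window_intervals p q) (interval_weight a l p q) (interval_charge s) (interval_charge t)"
  unfolding log_pgf_def weighted_inner_def sum.distrib[symmetric]
  by (intro sum.cong refl) (auto simp: interval_charge_def prod.distrib algebra_simps)

section \<open>Bounded limits of power products\<close>

text \<open>
  Power products serve as test functions because their expectations are values of joint generating
  functions and the product of two of them is again one.
\<close>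
inductive_set power_span :: "(int \<Rightarrow> 'w \<Rightarrow> nat) \<Rightarrow> int set \<Rightarrow> ('w \<Rightarrow> real) set"
  for X :: "int \<Rightarrow> 'w \<Rightarrow> nat" and S :: "int set" where
  power: "finite J \<Longrightarrow> J \<subseteq> S \<Longrightarrow> (\<And>k. 0 \<le> s k \<and> s k \<le> 1) \<Longrightarrow>
    (\<lambda>\<omega>. \<Prod>k\<in>J. s k ^ X k \<omega>) \<in> power_span X S"
| add: "f \<in> power_span X S \<Longrightarrow> g \<in> power_span X S \<Longrightarrow> (\<lambda>\<omega>. f \<omega> + g \<omega>) \<in> power_span X S"
| scale: "f \<in> power_span X S \<Longrightarrow> (\<lambda>\<omega>. c * f \<omega>) \<in> power_span X S"

text \<open>
  Limits are taken along sequences that are uniformly bounded on \<open>\<Omega>\<close>; these converge in mean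
  square under every probability measure on \<open>\<Omega>\<close> for which they are measurable.
\<close>
inductive_set bounded_closure :: "'w set \<Rightarrow> (int \<Rightarrow> 'w \<Rightarrow> nat) \<Rightarrow> int set \<Rightarrow> ('w \<Rightarrow> real) set"
  for \<Omega> :: "'w set" and X :: "int \<Rightarrow> 'w \<Rightarrow> nat" and S :: "int set" where
  span: "f \<in> power_span X S \<Longrightarrow> f \<in> bounded_closure \<Omega> X S"
| add: "f \<in> bounded_closure \<Omega> X S \<Longrightarrow> g \<in> bounded_closure \<Omega> X S \<Longrightarrow>
    (\<lambda>\<omega>. f \<omega> + g \<omega>) \<in> bounded_closure \<Omega> X S"
| scale: "f \<in> bounded_closure \<Omega> X S \<Longrightarrow> (\<lambda>\<omega>. c * f \<omega>) \<in> bounded_closure \<Omega> X S"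
| limit: "(\<And>n::nat. f n \<in> bounded_closure \<Omega> X S) \<Longrightarrow> (\<And>n \<omega>. \<omega> \<in> \<Omega> \<Longrightarrow> \<bar>f n \<omega>\<bar> \<le> B) \<Longrightarrow>
    (\<And>\<omega>. \<omega> \<in> \<Omega> \<Longrightarrow> (\<lambda>n. f n \<omega>) \<longlonglongrightarrow> g \<omega>) \<Longrightarrow> g \<in> bounded_closure \<Omega> X S"

lemma bounded_closure_bounded:
  assumes "f \<in> bounded_closure \<Omega> X S"
  shows "\<exists>B. \<forall>\<omega>\<in>\<Omega>. \<bar>f \<omega>\<bar> \<le> B"
  using assms
proof induction
  case (span f)
  then show ?case
  proof induction
    case (power J s)
    have "\<bar>\<Prod>k\<in>J. s k ^ X k \<omega>\<bar> \<le> 1" for \<omega>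
      using power by (auto simp: abs_prod intro!: prod_le_1 power_le_one)
    then show ?case by blast
  next
    case (add f g)
    then obtain A B where "\<And>\<omega>. \<omega> \<in> \<Omega> \<Longrightarrow> \<bar>f \<omega>\<bar> \<le> A" "\<And>\<omega>. \<omega> \<in> \<Omega> \<Longrightarrow> \<bar>g \<omega>\<bar> \<le> B" by metis
    then show ?case by (intro exI[of _ "A + B"]) (fastforce intro: order_trans[OF abs_triangle_ineq] add_mono)
  next
    case (scale f c)
    then obtain A where "\<And>\<omega>. \<omega> \<in> \<Omega> \<Longrightarrow> \<bar>f \<omega>\<bar> \<le> A" by metis
    then show ?case by (intro exI[of _ "\<bar>c\<bar> * A"]) (auto simp: abs_mult intro!: mult_left_mono)
  qed
next
  case (add f g)
  then obtain A B where "\<And>\<omega>. \<omega> \<in> \<Omega> \<Longrightarrow> \<bar>f \<omega>\<bar> \<le> A" "\<And>\<omega>. \<omega> \<in> \<Omega> \<Longrightarrow> \<bar>g \<omega>\<bar> \<le> B" by metis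
  then show ?case by (intro exI[of _ "A + B"]) (fastforce intro: order_trans[OF abs_triangle_ineq] add_mono)
next
  case (scale f c)
  then obtain A where "\<And>\<omega>. \<omega> \<in> \<Omega> \<Longrightarrow> \<bar>f \<omega>\<bar> \<le> A" by metis
  then show ?case by (intro exI[of _ "\<bar>c\<bar> * A"]) (auto simp: abs_mult intro!: mult_left_mono)
next
  case (limit f B g)
  have "\<bar>g \<omega>\<bar> \<le> B" if "\<omega> \<in> \<Omega>" for \<omega>
    using tendsto_rabs[OF limit.hyps(3)[OF that]] limit.hyps(2)[OF that] by (intro LIMSEQ_le_const2) auto
  then show ?case by blast
qed

lemma bounded_closure_cong:
  assumes "f \<in> bounded_closure \<Omega> X S" "\<And>\<omega>. \<omega> \<in> \<Omega> \<Longrightarrow> g \<omega> = f \<omega>"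
  shows "g \<in> bounded_closure \<Omega> X S"
proof -
  obtain B where "\<And>\<omega>. \<omega> \<in> \<Omega> \<Longrightarrow> \<bar>f \<omega>\<bar> \<le> B" using bounded_closure_bounded[OF assms(1)] by blast
  then show ?thesis using assms by (intro bounded_closure.limit[of "\<lambda>_. f" _ _ _ B g]) auto
qed

lemma bounded_closure_const: "(\<lambda>_. c) \<in> bounded_closure \<Omega> X S"
proof -
  have "(\<lambda>\<omega>. \<Prod>k\<in>{}. 1 ^ X k \<omega>) \<in> power_span X S"
    by (rule power_span.power) auto
  then have "(\<lambda>_. 1) \<in> bounded_closure \<Omega> X S" by (auto intro: bounded_closure.span)
  from bounded_closure.scale[OF this, of c] show ?thesis by simp
qed

lemma bounded_closure_diff:
  assumes "f \<in> bounded_closure \<Omega> X S" "g \<in> bounded_closure \<Omega> X S"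
  shows "(\<lambda>\<omega>. f \<omega> - g \<omega>) \<in> bounded_closure \<Omega> X S"
  using bounded_closure.add[OF assms(1) bounded_closure.scale[OF assms(2), of "-1"]] by simp

lemma bounded_closure_sum:
  assumes "finite A" "\<And>i. i \<in> A \<Longrightarrow> f i \<in> bounded_closure \<Omega> X S"
  shows "(\<lambda>\<omega>. \<Sum>i\<in>A. f i \<omega>) \<in> bounded_closure \<Omega> X S"
  using assms by (induction A) (auto intro: bounded_closure.add bounded_closure_const)

text \<open>
  Power products are closed under multiplication, and multiplication by a bounded function
  respects bounded limits.
\<close>
lemma bounded_closure_mult:
  assumes f: "f \<in> bounded_closure \<Omega> X S" and g: "g \<in> bounded_closure \<Omega> X S"
  shows "(\<lambda>\<omega>. f \<omega> * g \<omega>) \<in> bounded_closure \<Omega> X S"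
proof -
  have lim: "(\<lambda>\<omega>. f \<omega> * g \<omega>) \<in> bounded_closure \<Omega> X S"
    if h: "\<And>n::nat. (\<lambda>\<omega>. h n \<omega> * g \<omega>) \<in> bounded_closure \<Omega> X S" "\<And>n \<omega>. \<omega> \<in> \<Omega> \<Longrightarrow> \<bar>h n \<omega>\<bar> \<le> B"
      "\<And>\<omega>. \<omega> \<in> \<Omega> \<Longrightarrow> (\<lambda>n. h n \<omega>) \<longlonglongrightarrow> f \<omega>" "g \<in> bounded_closure \<Omega> X S"
    for h :: "nat \<Rightarrow> 'a \<Rightarrow> real" and f g B
  proof -
    obtain C where C: "\<And>\<omega>. \<omega> \<in> \<Omega> \<Longrightarrow> \<bar>g \<omega>\<bar> \<le> C" using bounded_closure_bounded[OF h(4)] by blast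
    show ?thesis
    proof (rule bounded_closure.limit[of "\<lambda>n \<omega>. h n \<omega> * g \<omega>" _ _ _ "\<bar>B\<bar> * \<bar>C\<bar>"])
      show "\<bar>h n \<omega> * g \<omega>\<bar> \<le> \<bar>B\<bar> * \<bar>C\<bar>" if "\<omega> \<in> \<Omega>" for n \<omega>
        unfolding abs_mult using C[OF that] h(2)[OF that, of n]
        by (intro mult_mono) auto
    qed (use h in \<open>auto intro!: tendsto_mult tendsto_const\<close>)
  qed
  have single: "(\<lambda>\<omega>. (\<Prod>k\<in>J. s k ^ X k \<omega>) * g \<omega>) \<in> bounded_closure \<Omega> X S"
    if J: "finite J" "J \<subseteq> S" "\<And>k. 0 \<le> s k \<and> s k \<le> 1" and g: "g \<in> bounded_closure \<Omega> X S" for J s g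
    using g
  proof induction
    case (span g)
    then show ?case
    proof induction
      case (power J' s')
      define r where "r k = (if k \<in> J then s k else 1) * (if k \<in> J' then s' k else 1)" for k
      have "(\<Prod>k\<in>J. s k ^ X k \<omega>) * (\<Prod>k\<in>J'. s' k ^ X k \<omega>) = (\<Prod>k\<in>J \<union> J'. r k ^ X k \<omega>)" for \<omega>
      proof -
        have "(\<Prod>k\<in>J. s k ^ X k \<omega>) = (\<Prod>k\<in>J \<union> J'. (if k \<in> J then s k else 1) ^ X k \<omega>)"
          using J power by (intro prod.mono_neutral_cong_left) auto
        moreover have "(\<Prod>k\<in>J'. s' k ^ X k \<omega>) = (\<Prod>k\<in>J \<union> J'. (if k \<in> J' then s' k else 1) ^ X k \<omega>)"
          using J power by (intro prod.mono_neutral_cong_left) auto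
        ultimately show ?thesis by (simp add: r_def power_mult_distrib prod.distrib)
      qed
      moreover have "(\<lambda>\<omega>. \<Prod>k\<in>J \<union> J'. r k ^ X k \<omega>) \<in> power_span X S"
        using J power by (intro power_span.power) (auto simp: r_def intro: mult_le_one)
      ultimately show ?case by (simp add: bounded_closure.span)
    next
      case (add f g)
      then show ?case using bounded_closure.add by (fastforce simp: distrib_left)
    next
      case (scale f c)
      then show ?case using bounded_closure.scale[of _ \<Omega> X S c] by (fastforce simp: mult.left_commute)
    qed
  next
    case (add f g)
    then show ?case using bounded_closure.add by (fastforce simp: distrib_left)
  next
    case (scale f c)
    then show ?case using bounded_closure.scale[of _ \<Omega> X S c] by (fastforce simp: mult.left_commute)
  next
    case (limit h B g)
    have "(\<lambda>\<omega>. \<Prod>k\<in>J. s k ^ X k \<omega>) \<in> bounded_closure \<Omega> X S"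
      using J by (intro bounded_closure.span power_span.power)
    from lim[of h _ B g, OF _ limit.hyps(2) limit.hyps(3) this] limit.IH show ?case
      by (simp add: mult.commute)
  qed
  show ?thesis
    using f
  proof induction
    case (span f)
    then show ?case
    proof induction
      case (power J s)
      then show ?case using single g by blast
    next
      case (add f g)
      then show ?case using bounded_closure.add by (fastforce simp: distrib_right)
    next
      case (scale f c)
      then show ?case using bounded_closure.scale[of _ \<Omega> X S c] by (fastforce simp: mult.assoc)
    qed
  next
    case (add f g)
    then show ?case using bounded_closure.add by (fastforce simp: distrib_right)
  next
    case (scale f c)
    then show ?case using bounded_closure.scale[of _ \<Omega> X S c] by (fastforce simp: mult.assoc)
  next
    case (limit h B f)
    show ?case by (rule lim[OF limit.IH limit.hyps(2,3) g])
  qed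
qed

text \<open>
  Once the values below \<open>j\<close> have been removed from \<open>t ^ X k\<close>, the rest divided by \<open>t ^ j\<close> stays
  in \<open>[0, 1]\<close> and tends to the indicator of \<open>X k = j\<close> as \<open>t\<close> tends to \<open>0\<close>.
\<close>
lemma bounded_closure_value:
  assumes "k \<in> S"
  shows "(\<lambda>\<omega>. of_bool (X k \<omega> = j)) \<in> bounded_closure \<Omega> X S"
proof (induction j rule: less_induct)
  case (less j)
  \<comment> \<open>any sequence in the open unit interval that tends to \<open>0\<close>\<close>
  define t where "t n = inverse (real (Suc (Suc n)))" for n
  have t: "0 < t n" "t n < 1" for n by (auto simp: t_def field_simps)
  have t0: "t \<longlonglongrightarrow> 0" unfolding t_def by (rule LIMSEQ_Suc[OF LIMSEQ_inverse_real_of_nat])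
  define f where "f n \<omega> = inverse (t n ^ j) * (t n ^ X k \<omega> - (\<Sum>i<j. t n ^ i * of_bool (X k \<omega> = i)))" for n \<omega>
  have f_eq: "f n \<omega> = (if X k \<omega> < j then 0 else t n ^ (X k \<omega> - j))" for n \<omega>
  proof -
    have "(\<Sum>i<j. t n ^ i * of_bool (X k \<omega> = i)) = (if X k \<omega> < j then t n ^ X k \<omega> else 0)"
      by (simp add: of_bool_def if_distrib[of "(*) _"] cong: if_cong)
    then show ?thesis using t[of n]
      by (auto simp: f_def power_diff field_simps)
  qed
  show ?case
  proof (rule bounded_closure.limit[of f _ _ _ 1])
    fix n
    have "(\<lambda>\<omega>. \<Prod>i\<in>{k}. t n ^ X i \<omega>) \<in> power_span X S"
      using assms t[of n] by (intro power_span.power) (auto intro: less_imp_le)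
    then have "(\<lambda>\<omega>. t n ^ X k \<omega>) \<in> bounded_closure \<Omega> X S" by (auto intro: bounded_closure.span)
    then show "f n \<in> bounded_closure \<Omega> X S"
      unfolding f_def
      by (intro bounded_closure.scale bounded_closure_diff bounded_closure_sum less.IH) auto
    show "\<bar>f n \<omega>\<bar> \<le> 1" for \<omega>
      using t[of n] by (auto simp: f_eq power_le_one)
  next
    fix \<omega>
    consider "X k \<omega> < j" | "X k \<omega> = j" | "j < X k \<omega>" by linarith
    then show "(\<lambda>n. f n \<omega>) \<longlonglongrightarrow> of_bool (X k \<omega> = j)"
    proof cases
      case 3
      then have "(\<lambda>n. t n ^ (X k \<omega> - j)) \<longlonglongrightarrow> 0 ^ (X k \<omega> - j)" by (intro tendsto_power t0)
      then show ?thesis using 3 by (simp add: f_eq power_0_left del: tendsto_power_zero)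
    qed (auto simp: f_eq)
  qed
qed

lemma sets_sigma_gen:
  "sets (sigma_gen M X S) = sigma_sets (space M) {X k -` B \<inter> space M | k B. k \<in> S}"
  unfolding sigma_gen_def by (rule sets_measure_of) auto

lemma space_sigma_gen [simp]: "space (sigma_gen M X S) = space M"
  unfolding sigma_gen_def by (rule space_measure_of) auto

text \<open>
  The closure is an algebra that is stable under bounded limits, so the events whose indicators
  it contains form a \<open>\<sigma>\<close>-field; it contains the generators by the preceding lemma.
\<close>
lemma indicator_bounded_closure:
  assumes "A \<in> sets (sigma_gen M X S)"
  shows "indicator A \<in> bounded_closure (space M) X S"
  using assms unfolding sets_sigma_gen
proof induction
  case (Basic A)
  then obtain k B where A: "A = X k -` B \<inter> space M" "k \<in> S" by auto
  show ?case
  proof (rule bounded_closure.limit[of "\<lambda>n \<omega>. \<Sum>j\<in>{..<n} \<inter> B. of_bool (X k \<omega> = j)" _ _ _ 1])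
    show "(\<lambda>\<omega>. \<Sum>j\<in>{..<n} \<inter> B. of_bool (X k \<omega> = j)) \<in> bounded_closure (space M) X S" for n
      using A by (intro bounded_closure_sum bounded_closure_value) auto
    have eq: "(\<Sum>j\<in>{..<n} \<inter> B. of_bool (X k \<omega> = j)) = (of_bool (X k \<omega> < n \<and> X k \<omega> \<in> B) :: real)" for n \<omega>
      by (simp add: of_bool_def)
    show "\<bar>\<Sum>j\<in>{..<n} \<inter> B. of_bool (X k \<omega> = j)\<bar> \<le> (1 :: real)" for n \<omega>
      unfolding eq by simp
    show "(\<lambda>n. \<Sum>j\<in>{..<n} \<inter> B. of_bool (X k \<omega> = j)) \<longlonglongrightarrow> (indicator A \<omega> :: real)" if "\<omega> \<in> space M" for \<omega>
      unfolding eq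
      by (rule tendsto_eventually, rule eventually_mono[OF eventually_gt_at_top[of "X k \<omega>"]])
         (use that A in \<open>auto simp: indicator_def\<close>)
  qed
next
  case Empty
  show ?case by (rule bounded_closure_cong[OF bounded_closure_const[of 0]]) simp
next
  case (Compl A)
  have "(\<lambda>\<omega>. 1 - indicator A \<omega> :: real) \<in> bounded_closure (space M) X S"
    by (intro bounded_closure_diff bounded_closure_const Compl)
  then show ?case by (rule bounded_closure_cong) (auto simp: indicator_def)
next
  case (Union A)
  have fin: "indicator (\<Union>i<n. A i) \<in> bounded_closure (space M) X S" for n
  proof (induction n)
    case 0
    show ?case by (rule bounded_closure_cong[OF bounded_closure_const[of 0]]) simp
  next
    case (Suc n)
    have "(\<lambda>\<omega>. 1 - (1 - indicator (\<Union>i<n. A i) \<omega>) * (1 - indicator (A n) \<omega>) :: real) \<in> bounded_closure (space M) X S"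
      by (intro bounded_closure_diff bounded_closure_mult bounded_closure_const Suc Union)
    then show ?case by (rule bounded_closure_cong) (auto simp: indicator_def less_Suc_eq)
  qed
  show ?case
  proof (rule bounded_closure.limit[of "\<lambda>n. indicator (\<Union>i<n. A i)" _ _ _ 1])
    show "(\<lambda>n. indicator (\<Union>i<n. A i) \<omega> :: real) \<longlonglongrightarrow> indicator (\<Union>i. A i) \<omega>" for \<omega>
      by (rule LIMSEQ_indicator_UN)
  qed (auto simp: fin indicator_def)
qed

section \<open>Approximation in mean square\<close>

context prob_space
begin

lemma square_integrable_mult:
  assumes "square_integrable M f" "square_integrable M g"
  shows "integrable M (\<lambda>\<omega>. f \<omega> * g \<omega>)"
proof (rule Bochner_Integration.integrable_bound)
  show "integrable M (\<lambda>\<omega>. (f \<omega>)\<^sup>2 + (g \<omega>)\<^sup>2)"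
    using assms by (auto simp: square_integrable_def)
  show "(\<lambda>\<omega>. f \<omega> * g \<omega>) \<in> borel_measurable M"
    using assms by (auto simp: square_integrable_def)
  have "\<bar>x * y\<bar> \<le> x\<^sup>2 + y\<^sup>2" for x y :: real
  proof -
    have "2 * \<bar>x * y\<bar> \<le> x\<^sup>2 + y\<^sup>2"
      using sum_squares_bound[of "\<bar>x\<bar>" "\<bar>y\<bar>"] by (simp add: abs_mult mult.assoc)
    then show ?thesis using abs_ge_zero[of "x * y"] by linarith
  qed
  then show "AE \<omega> in M. norm (f \<omega> * g \<omega>) \<le> norm ((f \<omega>)\<^sup>2 + (g \<omega>)\<^sup>2)"
    by (intro AE_I2) (simp only: real_norm_def abs_of_nonneg sum_power2_ge_zero)
qed

lemma square_integrable_const: "square_integrable M (\<lambda>_. c)"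
  by (simp add: square_integrable_def)

lemma square_integrable_integrable:
  assumes "square_integrable M f" shows "integrable M f"
  using square_integrable_mult[OF assms square_integrable_const[of 1]] by simp

lemma square_integrable_add:
  assumes "square_integrable M f" "square_integrable M g"
  shows "square_integrable M (\<lambda>\<omega>. f \<omega> + g \<omega>)"
  using assms square_integrable_mult[OF assms]
  by (auto simp: square_integrable_def power2_sum mult.assoc)

lemma square_integrable_scale:
  assumes "square_integrable M f"
  shows "square_integrable M (\<lambda>\<omega>. c * f \<omega>)"
  using assms by (auto simp: square_integrable_def power_mult_distrib)

lemma square_integrable_diff:
  assumes "square_integrable M f" "square_integrable M g"
  shows "square_integrable M (\<lambda>\<omega>. f \<omega> - g \<omega>)"
  using square_integrable_add[OF assms(1) square_integrable_scale[OF assms(2), of "-1"]] by simp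

lemma square_integrable_bounded:
  assumes "f \<in> borel_measurable M" "\<And>\<omega>. \<omega> \<in> space M \<Longrightarrow> \<bar>f \<omega>\<bar> \<le> B"
  shows "square_integrable M f"
proof -
  have "\<bar>(f \<omega>)\<^sup>2\<bar> \<le> B\<^sup>2" if "\<omega> \<in> space M" for \<omega>
    using power_mono[OF assms(2)[OF that], of 2] by simp
  then have "integrable M (\<lambda>\<omega>. (f \<omega>)\<^sup>2)"
    using assms(1) by (intro integrable_const_bound[of _ "B\<^sup>2"]) auto
  with assms(1) show ?thesis by (simp add: square_integrable_def)
qed

lemma Cauchy_Schwarz_integral:
  assumes f: "square_integrable M f" and g: "square_integrable M g"
  shows "\<bar>\<integral>\<omega>. f \<omega> * g \<omega> \<partial>M\<bar> \<le> sqrt (\<integral>\<omega>. (f \<omega>)\<^sup>2 \<partial>M) * sqrt (\<integral>\<omega>. (g \<omega>)\<^sup>2 \<partial>M)"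
proof -
  define A B C where "A = (\<integral>\<omega>. (f \<omega>)\<^sup>2 \<partial>M)" and "B = (\<integral>\<omega>. (g \<omega>)\<^sup>2 \<partial>M)" and "C = (\<integral>\<omega>. f \<omega> * g \<omega> \<partial>M)"
  have q: "0 \<le> A - 2 * t * C + t\<^sup>2 * B" for t
  proof -
    have "0 \<le> (\<integral>\<omega>. (f \<omega> - t * g \<omega>)\<^sup>2 \<partial>M)" by simp
    also have "\<dots> = (\<integral>\<omega>. (f \<omega>)\<^sup>2 - 2 * t * (f \<omega> * g \<omega>) + t\<^sup>2 * (g \<omega>)\<^sup>2 \<partial>M)"
      by (intro Bochner_Integration.integral_cong refl) (simp add: power2_eq_square algebra_simps)
    also have "\<dots> = A - 2 * t * C + t\<^sup>2 * B"
      using f g square_integrable_mult[OF f g] by (simp add: square_integrable_def A_def B_def C_def)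
    finally show ?thesis .
  qed
  have "0 \<le> A" "0 \<le> B" by (simp_all add: A_def B_def)
  have "C\<^sup>2 \<le> A * B"
  proof (cases "B = 0")
    case True
    have "C = 0"
    proof (rule ccontr)
      assume "C \<noteq> 0"
      then show False using q[of "(A + 1) / (2 * C)"] True by (simp add: field_simps)
    qed
    then show ?thesis using True by simp
  next
    case False
    then have "0 < B" using \<open>0 \<le> B\<close> by simp
    have "0 \<le> (A - 2 * (C / B) * C + (C / B)\<^sup>2 * B) * B"
      using q[of "C / B"] \<open>0 < B\<close> by (intro mult_nonneg_nonneg) auto
    also have "\<dots> = A * B - C\<^sup>2" using \<open>0 < B\<close> by (simp add: field_simps power2_eq_square)
    finally show ?thesis by simp
  qed
  then have "sqrt (C\<^sup>2) \<le> sqrt (A * B)" by (rule real_sqrt_le_mono)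
  then show ?thesis by (simp add: A_def B_def C_def real_sqrt_mult)
qed

text \<open>
  Covariances and variances are continuous in mean square, which is how a covariance
  bound passes from a dense set of functions to all square-integrable ones.
\<close>
lemma L2_limit_mult:
  assumes f: "square_integrable M f" "\<And>n. square_integrable M (F n)"
      "(\<lambda>n. \<integral>\<omega>. (F n \<omega> - f \<omega>)\<^sup>2 \<partial>M) \<longlonglongrightarrow> 0"
    and g: "square_integrable M g" "\<And>n. square_integrable M (G n)"
      "(\<lambda>n. \<integral>\<omega>. (G n \<omega> - g \<omega>)\<^sup>2 \<partial>M) \<longlonglongrightarrow> 0"
  shows "(\<lambda>n. \<integral>\<omega>. F n \<omega> * G n \<omega> \<partial>M) \<longlonglongrightarrow> (\<integral>\<omega>. f \<omega> * g \<omega> \<partial>M)"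
proof (rule LIM_zero_cancel, rule Lim_null_comparison)
  let ?n = "\<lambda>h. sqrt (\<integral>\<omega>. (h \<omega> :: real)\<^sup>2 \<partial>M)"
  let ?dF = "\<lambda>n \<omega>. F n \<omega> - f \<omega>" and ?dG = "\<lambda>n \<omega>. G n \<omega> - g \<omega>"
  note d = square_integrable_diff[OF f(2) f(1)] square_integrable_diff[OF g(2) g(1)]
  show "\<forall>\<^sub>F n in sequentially.
    norm ((\<integral>\<omega>. F n \<omega> * G n \<omega> \<partial>M) - (\<integral>\<omega>. f \<omega> * g \<omega> \<partial>M)) \<le>
      ?n (?dF n) * ?n (?dG n) + ?n (?dF n) * ?n g + ?n f * ?n (?dG n)"
  proof (intro always_eventually allI)
    fix n
    have "(\<integral>\<omega>. F n \<omega> * G n \<omega> \<partial>M) =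
      (\<integral>\<omega>. ?dF n \<omega> * ?dG n \<omega> + ?dF n \<omega> * g \<omega> + f \<omega> * ?dG n \<omega> + f \<omega> * g \<omega> \<partial>M)"
      by (intro Bochner_Integration.integral_cong refl) (simp add: algebra_simps)
    also have "\<dots> = (\<integral>\<omega>. ?dF n \<omega> * ?dG n \<omega> \<partial>M) + (\<integral>\<omega>. ?dF n \<omega> * g \<omega> \<partial>M) + (\<integral>\<omega>. f \<omega> * ?dG n \<omega> \<partial>M) + (\<integral>\<omega>. f \<omega> * g \<omega> \<partial>M)"
      using square_integrable_mult[OF d(1) d(2), of n n] square_integrable_mult[OF d(1) g(1), of n]
        square_integrable_mult[OF f(1) d(2), of n] square_integrable_mult[OF f(1) g(1)]
      by (simp only: Bochner_Integration.integral_add Bochner_Integration.integrable_add)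
    finally show "norm ((\<integral>\<omega>. F n \<omega> * G n \<omega> \<partial>M) - (\<integral>\<omega>. f \<omega> * g \<omega> \<partial>M)) \<le>
      ?n (?dF n) * ?n (?dG n) + ?n (?dF n) * ?n g + ?n f * ?n (?dG n)"
      using Cauchy_Schwarz_integral[OF d(1) d(2), of n n] Cauchy_Schwarz_integral[OF d(1) g(1), of n]
        Cauchy_Schwarz_integral[OF f(1) d(2), of n]
      unfolding real_norm_def by linarith
  qed
  have z: "(\<lambda>n. ?n (?dF n)) \<longlonglongrightarrow> 0" "(\<lambda>n. ?n (?dG n)) \<longlonglongrightarrow> 0"
    using tendsto_real_sqrt[OF f(3)] tendsto_real_sqrt[OF g(3)] by simp_all
  show "(\<lambda>n. ?n (?dF n) * ?n (?dG n) + ?n (?dF n) * ?n g + ?n f * ?n (?dG n)) \<longlonglongrightarrow> 0"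
    using tendsto_add[OF tendsto_add[OF tendsto_mult[OF z] tendsto_mult[OF z(1) tendsto_const[of "?n g"]]]
        tendsto_mult[OF tendsto_const[of "?n f"] z(2)]] by simp
qed

lemma integral_square_add_le:
  assumes "square_integrable M f" "square_integrable M g"
  shows "(\<integral>\<omega>. (f \<omega> + g \<omega>)\<^sup>2 \<partial>M) \<le> 2 * (\<integral>\<omega>. (f \<omega>)\<^sup>2 \<partial>M) + 2 * (\<integral>\<omega>. (g \<omega>)\<^sup>2 \<partial>M)"
proof -
  have le: "(x + y)\<^sup>2 \<le> 2 * x\<^sup>2 + 2 * y\<^sup>2" for x y :: real
    using zero_le_power2[of "x - y"] by (simp add: power2_eq_square algebra_simps)
  have "(\<integral>\<omega>. (f \<omega> + g \<omega>)\<^sup>2 \<partial>M) \<le> (\<integral>\<omega>. 2 * (f \<omega>)\<^sup>2 + 2 * (g \<omega>)\<^sup>2 \<partial>M)"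
    using assms square_integrable_add[OF assms] le
    by (intro integral_mono) (auto simp: square_integrable_def)
  also have "\<dots> = 2 * (\<integral>\<omega>. (f \<omega>)\<^sup>2 \<partial>M) + 2 * (\<integral>\<omega>. (g \<omega>)\<^sup>2 \<partial>M)"
    using assms by (simp add: square_integrable_def)
  finally show ?thesis .
qed

definition L2_approximable :: "('a \<Rightarrow> real) set \<Rightarrow> ('a \<Rightarrow> real) \<Rightarrow> bool" where
  "L2_approximable H f \<longleftrightarrow> square_integrable M f \<and>
     (\<forall>\<epsilon>>0. \<exists>h\<in>H. square_integrable M h \<and> (\<integral>\<omega>. (h \<omega> - f \<omega>)\<^sup>2 \<partial>M) < \<epsilon>)"

lemma L2_approximable_limit:
  assumes F: "\<And>n. L2_approximable H (F n)" and f: "square_integrable M f"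
    and lim: "(\<lambda>n. \<integral>\<omega>. (F n \<omega> - f \<omega>)\<^sup>2 \<partial>M) \<longlonglongrightarrow> 0"
  shows "L2_approximable H f"
  unfolding L2_approximable_def
proof (intro conjI allI impI f)
  fix \<epsilon> :: real assume \<epsilon>: "0 < \<epsilon>"
  from order_tendstoD(2)[OF lim, of "\<epsilon> / 4"] \<epsilon>
  obtain n where n: "(\<integral>\<omega>. (F n \<omega> - f \<omega>)\<^sup>2 \<partial>M) < \<epsilon> / 4"
    by (auto simp: eventually_sequentially)
  have Fn: "square_integrable M (F n)" using F by (simp add: L2_approximable_def)
  obtain h where h: "h \<in> H" "square_integrable M h" "(\<integral>\<omega>. (h \<omega> - F n \<omega>)\<^sup>2 \<partial>M) < \<epsilon> / 4"
    using F[of n] \<epsilon> unfolding L2_approximable_def by (meson divide_pos_pos zero_less_numeral)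
  have "(\<integral>\<omega>. (h \<omega> - f \<omega>)\<^sup>2 \<partial>M) < \<epsilon>"
    using integral_square_add_le[OF square_integrable_diff[OF h(2) Fn] square_integrable_diff[OF Fn f]] n h(3)
    by simp
  with h show "\<exists>h\<in>H. square_integrable M h \<and> (\<integral>\<omega>. (h \<omega> - f \<omega>)\<^sup>2 \<partial>M) < \<epsilon>" by blast
qed

lemma dominated_L2_limit:
  assumes f: "f \<in> borel_measurable M" and F: "\<And>n. F n \<in> borel_measurable M"
    and lim: "\<And>\<omega>. \<omega> \<in> space M \<Longrightarrow> (\<lambda>n. F n \<omega>) \<longlonglongrightarrow> f \<omega>"
    and dom: "\<And>n \<omega>. \<omega> \<in> space M \<Longrightarrow> \<bar>F n \<omega> - f \<omega>\<bar> \<le> w \<omega>" and w: "square_integrable M w"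
  shows "(\<lambda>n. \<integral>\<omega>. (F n \<omega> - f \<omega>)\<^sup>2 \<partial>M) \<longlonglongrightarrow> 0"
proof -
  have "(\<lambda>n. \<integral>\<omega>. (F n \<omega> - f \<omega>)\<^sup>2 \<partial>M) \<longlonglongrightarrow> (\<integral>\<omega>. 0 \<partial>M)"
  proof (rule integral_dominated_convergence[where w = "\<lambda>\<omega>. (w \<omega>)\<^sup>2"])
    show "AE \<omega> in M. (\<lambda>n. (F n \<omega> - f \<omega>)\<^sup>2) \<longlonglongrightarrow> 0"
    proof (intro AE_I2)
      fix \<omega> assume "\<omega> \<in> space M"
      from tendsto_power[OF tendsto_diff[OF lim[OF this] tendsto_const[of "f \<omega>"]], of 2]
      show "(\<lambda>n. (F n \<omega> - f \<omega>)\<^sup>2) \<longlonglongrightarrow> 0" by simp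
    qed
    show "AE \<omega> in M. norm ((F n \<omega> - f \<omega>)\<^sup>2) \<le> (w \<omega>)\<^sup>2" for n
      using dom by (intro AE_I2) (simp add: abs_le_square_iff[symmetric] order_trans[OF _ abs_ge_self])
  qed (use f F w in \<open>auto simp: square_integrable_def\<close>)
  then show ?thesis by simp
qed

lemma power_span_measurable:
  assumes X: "\<And>k. X k \<in> M \<rightarrow>\<^sub>M count_space UNIV" and f: "f \<in> power_span X S"
  shows "f \<in> borel_measurable M"
  using f
proof induction
  case (power J s)
  have "(\<lambda>\<omega>. s k ^ X k \<omega>) \<in> borel_measurable M" for k
    using X[of k] by (rule measurable_compose) simp
  then show ?case by (intro borel_measurable_prod)
qed auto

lemma power_span_square_integrable:
  assumes X: "\<And>k. X k \<in> M \<rightarrow>\<^sub>M count_space UNIV" and f: "f \<in> power_span X S"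
  shows "square_integrable M f"
  using bounded_closure_bounded[OF bounded_closure.span[OF f, of "space M"]]
    square_integrable_bounded[OF power_span_measurable[OF X f]] by blast

lemma L2_approximable_span:
  assumes X: "\<And>k. X k \<in> M \<rightarrow>\<^sub>M count_space UNIV" and f: "f \<in> power_span X S"
  shows "L2_approximable (power_span X S) f"
  using power_span_square_integrable[OF X f] f by (auto simp: L2_approximable_def intro!: bexI[of _ f])

lemma bounded_closure_L2_approximable:
  assumes X: "\<And>k. X k \<in> M \<rightarrow>\<^sub>M count_space UNIV" and f: "f \<in> bounded_closure (space M) X S"
  shows "L2_approximable (power_span X S) f"
  using f
proof induction
  case (span f)
  then show ?case by (rule L2_approximable_span[OF X])
next
  case (add f g)
  then have sq: "square_integrable M f" "square_integrable M g" by (auto simp: L2_approximable_def)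
  show ?case
    unfolding L2_approximable_def
  proof (intro conjI allI impI square_integrable_add sq)
    fix \<epsilon> :: real assume \<epsilon>: "0 < \<epsilon>"
    then have "0 < \<epsilon> / 4" by simp
    obtain h where h: "h \<in> power_span X S" "square_integrable M h" "(\<integral>\<omega>. (h \<omega> - f \<omega>)\<^sup>2 \<partial>M) < \<epsilon> / 4"
      using add.IH(1) \<open>0 < \<epsilon> / 4\<close> unfolding L2_approximable_def by blast
    obtain k where k: "k \<in> power_span X S" "square_integrable M k" "(\<integral>\<omega>. (k \<omega> - g \<omega>)\<^sup>2 \<partial>M) < \<epsilon> / 4"
      using add.IH(2) \<open>0 < \<epsilon> / 4\<close> unfolding L2_approximable_def by blast
    have "(\<integral>\<omega>. (h \<omega> + k \<omega> - (f \<omega> + g \<omega>))\<^sup>2 \<partial>M) = (\<integral>\<omega>. (h \<omega> - f \<omega> + (k \<omega> - g \<omega>))\<^sup>2 \<partial>M)"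
      by (simp add: algebra_simps)
    also have "\<dots> < \<epsilon>"
      using integral_square_add_le[OF square_integrable_diff[OF h(2) sq(1)] square_integrable_diff[OF k(2) sq(2)]] h(3) k(3)
      by simp
    finally show "\<exists>h\<in>power_span X S. square_integrable M h \<and> (\<integral>\<omega>. (h \<omega> - (f \<omega> + g \<omega>))\<^sup>2 \<partial>M) < \<epsilon>"
      using power_span.add[OF h(1) k(1)] square_integrable_add[OF h(2) k(2)] by blast
  qed
next
  case (scale f c)
  then have sq: "square_integrable M f" by (auto simp: L2_approximable_def)
  show ?case
    unfolding L2_approximable_def
  proof (intro conjI allI impI square_integrable_scale sq)
    fix \<epsilon> :: real assume \<epsilon>: "0 < \<epsilon>"
    then have \<epsilon>': "0 < \<epsilon> / (c\<^sup>2 + 1)" by (simp add: add_nonneg_pos)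
    obtain h where h: "h \<in> power_span X S" "square_integrable M h" "(\<integral>\<omega>. (h \<omega> - f \<omega>)\<^sup>2 \<partial>M) < \<epsilon> / (c\<^sup>2 + 1)"
      using scale.IH \<epsilon>' unfolding L2_approximable_def by blast
    have "(\<integral>\<omega>. (c * h \<omega> - c * f \<omega>)\<^sup>2 \<partial>M) = c\<^sup>2 * (\<integral>\<omega>. (h \<omega> - f \<omega>)\<^sup>2 \<partial>M)"
      by (simp add: right_diff_distrib[symmetric] power_mult_distrib)
    also have "\<dots> \<le> (c\<^sup>2 + 1) * (\<integral>\<omega>. (h \<omega> - f \<omega>)\<^sup>2 \<partial>M)" by (intro mult_right_mono) auto
    also have "\<dots> < \<epsilon>" using h(3) by (simp add: pos_less_divide_eq add_nonneg_pos mult.commute)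
    finally show "\<exists>h\<in>power_span X S. square_integrable M h \<and> (\<integral>\<omega>. (h \<omega> - c * f \<omega>)\<^sup>2 \<partial>M) < \<epsilon>"
      using power_span.scale[OF h(1), of c] square_integrable_scale[OF h(2), of c] by blast
  qed
next
  case (limit f B g)
  have m: "f n \<in> borel_measurable M" for n using limit.IH[of n] by (simp add: L2_approximable_def square_integrable_def)
  have gm: "g \<in> borel_measurable M"
    by (rule borel_measurable_LIMSEQ_real[of M f g]) (use m limit.hyps in auto)
  have gB: "\<bar>g \<omega>\<bar> \<le> B" if "\<omega> \<in> space M" for \<omega>
    using tendsto_rabs[OF limit.hyps(3)[OF that]] limit.hyps(2)[OF that] by (intro LIMSEQ_le_const2) auto
  show ?case
  proof (rule L2_approximable_limit[OF limit.IH])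
    show "square_integrable M g" by (rule square_integrable_bounded[OF gm gB])
    show "(\<lambda>n. \<integral>\<omega>. (f n \<omega> - g \<omega>)\<^sup>2 \<partial>M) \<longlonglongrightarrow> 0"
    proof (rule dominated_L2_limit[OF gm m limit.hyps(3) _ square_integrable_const[of "2 * B"]])
      show "\<bar>f n \<omega> - g \<omega>\<bar> \<le> 2 * B" if "\<omega> \<in> space M" for n \<omega>
        using limit.hyps(2)[OF that, of n] gB[OF that] by linarith
    qed
  qed
qed

lemma sigma_gen_subalgebra:
  assumes X: "\<And>k. X k \<in> M \<rightarrow>\<^sub>M count_space UNIV"
  shows "subalgebra M (sigma_gen M X S)"
  unfolding subalgebra_def sets_sigma_gen
  using X by (auto intro!: sets.sigma_sets_subset measurable_sets)

text \<open>
  The density statement: power products over finite subsets of \<open>S\<close> suffice even if \<open>S\<close> is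
  infinite, because \<open>f\<close> is a dominated limit of simple functions over \<open>\<sigma>(X k, k \<in> S)\<close>.
\<close>
lemma sigma_gen_L2_approximable:
  fixes X :: "int \<Rightarrow> 'a \<Rightarrow> nat"
  assumes X: "\<And>k. X k \<in> M \<rightarrow>\<^sub>M count_space UNIV"
    and f: "f \<in> borel_measurable (sigma_gen M X S)" "square_integrable M f"
  shows "L2_approximable (power_span X S) f"
proof -
  let ?F = "sigma_gen M X S"
  obtain F where F: "\<And>i. simple_function ?F (F i)"
    "\<And>\<omega>. \<omega> \<in> space M \<Longrightarrow> (\<lambda>i. F i \<omega>) \<longlonglongrightarrow> f \<omega>"
    "\<And>i \<omega>. \<omega> \<in> space M \<Longrightarrow> \<bar>F i \<omega>\<bar> \<le> 2 * \<bar>f \<omega>\<bar>"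
    using borel_measurable_implies_sequence_metric[OF f(1), of 0]
    unfolding dist_real_def diff_0_right space_sigma_gen by blast
  have Fc: "F i \<in> bounded_closure (space M) X S" for i
  proof (rule bounded_closure_cong)
    let ?Y = "F i ` space M"
    show "(\<lambda>\<omega>. \<Sum>y\<in>?Y. y * indicator (F i -` {y} \<inter> space M) \<omega>) \<in> bounded_closure (space M) X S"
      using simple_functionD[OF F(1)[of i]]
      by (intro bounded_closure_sum bounded_closure.scale indicator_bounded_closure) auto
    show "F i \<omega> = (\<Sum>y\<in>?Y. y * indicator (F i -` {y} \<inter> space M) \<omega>)" if "\<omega> \<in> space M" for \<omega>
    proof -
      have "finite ?Y" using simple_functionD(1)[OF F(1)[of i]] by simp
      have "(\<Sum>y\<in>?Y. y * indicator (F i -` {y} \<inter> space M) \<omega>) = (\<Sum>y\<in>?Y. if y = F i \<omega> then y else 0)"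
        using that by (intro sum.cong) (auto simp: indicator_def)
      also have "\<dots> = F i \<omega>" using that \<open>finite ?Y\<close> by simp
      finally show ?thesis by simp
    qed
  qed
  have Fa: "L2_approximable (power_span X S) (F i)" for i
    by (rule bounded_closure_L2_approximable[OF X Fc])
  have fm: "f \<in> borel_measurable M" using f by (simp add: square_integrable_def)
  show ?thesis
  proof (rule L2_approximable_limit[OF Fa f(2)])
    show "(\<lambda>n. \<integral>\<omega>. (F n \<omega> - f \<omega>)\<^sup>2 \<partial>M) \<longlonglongrightarrow> 0"
    proof (rule dominated_L2_limit[OF fm _ F(2)])
      show "F n \<in> borel_measurable M" for n using Fa[of n] by (simp add: L2_approximable_def square_integrable_def)
      show "square_integrable M (\<lambda>\<omega>. 3 * \<bar>f \<omega>\<bar>)"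
        using f(2) by (intro square_integrable_scale) (auto simp: square_integrable_def)
      show "\<bar>F n \<omega> - f \<omega>\<bar> \<le> 3 * \<bar>f \<omega>\<bar>" if "\<omega> \<in> space M" for n \<omega>
        using F(3)[OF that, of n] by linarith
    qed
  qed
qed

lemma integral_centred_mult:
  assumes "square_integrable M f" "square_integrable M g"
  shows "(\<integral>\<omega>. (f \<omega> - (\<integral>x. f x \<partial>M)) * (g \<omega> - (\<integral>x. g x \<partial>M)) \<partial>M) =
    (\<integral>\<omega>. f \<omega> * g \<omega> \<partial>M) - (\<integral>\<omega>. f \<omega> \<partial>M) * (\<integral>\<omega>. g \<omega> \<partial>M)"
proof -
  let ?m = "\<integral>x. f x \<partial>M" and ?k = "\<integral>x. g x \<partial>M"
  have "(\<integral>\<omega>. (f \<omega> - ?m) * (g \<omega> - ?k) \<partial>M) = (\<integral>\<omega>. f \<omega> * g \<omega> - ?k * f \<omega> - ?m * g \<omega> + ?m * ?k \<partial>M)"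
    by (intro Bochner_Integration.integral_cong refl) (simp add: algebra_simps)
  also have "\<dots> = (\<integral>\<omega>. f \<omega> * g \<omega> \<partial>M) - ?k * ?m - ?m * ?k + ?m * ?k"
    using square_integrable_mult[OF assms] assms[THEN square_integrable_integrable] prob_space by simp
  finally show ?thesis by simp
qed

lemma corr_bound_from_dense:
  assumes f: "L2_approximable H f" and g: "L2_approximable K g" and \<kappa>: "0 \<le> \<kappa>"
    and bound: "\<And>h k. h \<in> H \<Longrightarrow> k \<in> K \<Longrightarrow>
      \<bar>(\<integral>\<omega>. h \<omega> * k \<omega> \<partial>M) - (\<integral>\<omega>. h \<omega> \<partial>M) * (\<integral>\<omega>. k \<omega> \<partial>M)\<bar> \<le>
      \<kappa> * (sqrt ((\<integral>\<omega>. h \<omega> * h \<omega> \<partial>M) - (\<integral>\<omega>. h \<omega> \<partial>M) * (\<integral>\<omega>. h \<omega> \<partial>M)) *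
           sqrt ((\<integral>\<omega>. k \<omega> * k \<omega> \<partial>M) - (\<integral>\<omega>. k \<omega> \<partial>M) * (\<integral>\<omega>. k \<omega> \<partial>M)))"
  shows "\<bar>corr M f g\<bar> \<le> \<kappa>"
proof -
  have seq: "\<exists>F. (\<forall>n. F n \<in> H) \<and> (\<forall>n. square_integrable M (F n)) \<and> (\<lambda>n. \<integral>\<omega>. (F n \<omega> - f \<omega>)\<^sup>2 \<partial>M) \<longlonglongrightarrow> 0"
    if "L2_approximable H f" for f and H :: "('a \<Rightarrow> real) set"
  proof -
    have "\<forall>n. \<exists>h. h \<in> H \<and> square_integrable M h \<and> (\<integral>\<omega>. (h \<omega> - f \<omega>)\<^sup>2 \<partial>M) < inverse (real (Suc n))"
      using that unfolding L2_approximable_def by (metis inverse_positive_iff_positive of_nat_0_less_iff zero_less_Suc)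
    then obtain F where F: "\<And>n. F n \<in> H" "\<And>n. square_integrable M (F n)"
      "\<And>n. (\<integral>\<omega>. (F n \<omega> - f \<omega>)\<^sup>2 \<partial>M) < inverse (real (Suc n))" by metis
    have "(\<lambda>n. \<integral>\<omega>. (F n \<omega> - f \<omega>)\<^sup>2 \<partial>M) \<longlonglongrightarrow> 0"
      by (rule tendsto_sandwich[OF _ _ tendsto_const LIMSEQ_inverse_real_of_nat])
         (simp, intro always_eventually allI less_imp_le[OF F(3)])
    with F show ?thesis by blast
  qed
  obtain F where F: "\<And>n. F n \<in> H" "\<And>n. square_integrable M (F n)" "(\<lambda>n. \<integral>\<omega>. (F n \<omega> - f \<omega>)\<^sup>2 \<partial>M) \<longlonglongrightarrow> 0"
    using seq[OF f] by blast
  obtain G where G: "\<And>n. G n \<in> K" "\<And>n. square_integrable M (G n)" "(\<lambda>n. \<integral>\<omega>. (G n \<omega> - g \<omega>)\<^sup>2 \<partial>M) \<longlonglongrightarrow> 0"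
    using seq[OF g] by blast
  have fs: "square_integrable M f" and gs: "square_integrable M g"
    using f g by (auto simp: L2_approximable_def)
  have E: "(\<lambda>n. \<integral>\<omega>. F n \<omega> \<partial>M) \<longlonglongrightarrow> (\<integral>\<omega>. f \<omega> \<partial>M)"
    using L2_limit_mult[OF fs F(2,3) square_integrable_const[of 1] square_integrable_const[of 1]] by simp
  have E': "(\<lambda>n. \<integral>\<omega>. G n \<omega> \<partial>M) \<longlonglongrightarrow> (\<integral>\<omega>. g \<omega> \<partial>M)"
    using L2_limit_mult[OF gs G(2,3) square_integrable_const[of 1] square_integrable_const[of 1]] by simp
  let ?c = "\<lambda>f g. (\<integral>\<omega>. f \<omega> * g \<omega> \<partial>M) - (\<integral>\<omega>. f \<omega> \<partial>M) * (\<integral>\<omega>. g \<omega> \<partial>M) :: real"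
  have "\<bar>?c f g\<bar> \<le> \<kappa> * (sqrt (?c f f) * sqrt (?c g g))"
  proof (rule LIMSEQ_le)
    show "(\<lambda>n. \<bar>?c (F n) (G n)\<bar>) \<longlonglongrightarrow> \<bar>?c f g\<bar>"
      by (intro tendsto_rabs tendsto_diff tendsto_mult E E' L2_limit_mult[OF fs F(2,3) gs G(2,3)])
    show "(\<lambda>n. \<kappa> * (sqrt (?c (F n) (F n)) * sqrt (?c (G n) (G n)))) \<longlonglongrightarrow> \<kappa> * (sqrt (?c f f) * sqrt (?c g g))"
      by (intro tendsto_const tendsto_real_sqrt tendsto_diff tendsto_mult E E'
          L2_limit_mult[OF fs F(2,3) fs F(2,3)] L2_limit_mult[OF gs G(2,3) gs G(2,3)])
  qed (use bound[OF F(1) G(1)] in blast)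
  moreover have "corr M f g = ?c f g / (sqrt (?c f f) * sqrt (?c g g))"
    unfolding corr_def power2_eq_square
    by (simp only: integral_centred_mult[OF fs gs] integral_centred_mult[OF fs fs] integral_centred_mult[OF gs gs])
  moreover have "0 \<le> ?c f f" "0 \<le> ?c g g"
    unfolding integral_centred_mult[OF fs fs, symmetric] integral_centred_mult[OF gs gs, symmetric]
    by (simp_all add: power2_eq_square[symmetric])
  then have "0 \<le> sqrt (?c f f) * sqrt (?c g g)" by simp
  moreover have "\<bar>x / d\<bar> \<le> \<kappa>" if "0 \<le> d" "\<bar>x\<bar> \<le> \<kappa> * d" for x d :: real
    using that \<kappa> by (cases "d = 0") (auto simp: divide_le_eq)
  ultimately show ?thesis by simp
qed

end

section \<open>Thinning of the past\<close>

lemma poisson_pgf: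
  assumes l: "0 < l" and s: "0 \<le> s"
  shows "(\<integral>n. s ^ n \<partial>measure_pmf (poisson_pmf l)) = exp (l * (s - 1))"
proof -
  have sums: "(\<lambda>n. l ^ n / fact n * exp (- l) * s ^ n) sums exp (l * (s - 1))"
  proof -
    have "(\<lambda>n. exp (- l) * ((l * s) ^ n /\<^sub>R fact n)) sums (exp (- l) * exp (l * s))"
      by (intro sums_mult exp_converges)
    moreover have "exp (- l) * exp (l * s) = exp (l * (s - 1))"
      by (simp add: exp_add[symmetric] algebra_simps)
    ultimately show ?thesis by (simp add: field_simps power_mult_distrib)
  qed
  have "(\<integral>\<^sup>+n. ennreal (s ^ n) \<partial>measure_pmf (poisson_pmf l)) =
    (\<integral>\<^sup>+n. ennreal (l ^ n / fact n * exp (- l) * s ^ n) \<partial>count_space UNIV)"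
    unfolding nn_integral_measure_pmf
    by (intro nn_integral_cong) (simp add: l s ennreal_mult''[symmetric])
  also have "\<dots> = ennreal (\<Sum>n. l ^ n / fact n * exp (- l) * s ^ n)"
    unfolding nn_integral_count_space_nat
    using l s sums by (intro suminf_ennreal2) (auto intro: sums_summable)
  also have "\<dots> = ennreal (exp (l * (s - 1)))" using sums by (simp add: sums_iff)
  finally show ?thesis using s by (subst integral_eq_nn_integral) auto
qed

lemma binomial_pgf:
  fixes s :: real
  assumes a: "0 < a" "a < 1"
  shows "(\<integral>n. s ^ n \<partial>measure_pmf (binomial_pmf x a)) = (1 - a + a * s) ^ x"
proof -
  have "(\<integral>n. s ^ n \<partial>measure_pmf (binomial_pmf x a)) = (\<Sum>k\<le>x. real (x choose k) * (a * s) ^ k * (1 - a) ^ (x - k))"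
    using a by (subst expectation_binomial_pmf') (auto simp: power_mult_distrib mult_ac intro!: sum.cong)
  also have "\<dots> = (a * s + (1 - a)) ^ x" by (simp add: binomial_ring)
  finally show ?thesis by (simp add: add.commute)
qed

locale poisson_inar = prob_space M for M :: "'w measure" +
  fixes a l :: real and X U V :: "int \<Rightarrow> 'w \<Rightarrow> nat"
  assumes a: "0 < a" "a < 1" and l: "0 < l"
    and meas: "\<And>k. X k \<in> M \<rightarrow>\<^sub>M count_space UNIV" "\<And>k. U k \<in> M \<rightarrow>\<^sub>M count_space UNIV"
      "\<And>k. V k \<in> M \<rightarrow>\<^sub>M count_space UNIV"
    and stationary: "strictly_stationary M X"
    and decomposition: "\<And>k \<omega>. \<omega> \<in> space M \<Longrightarrow> X k \<omega> = U k \<omega> + V k \<omega>"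
    and thinning: "\<And>k x. 0 < measure M {\<omega>\<in>space M. X (k - 1) \<omega> = x} \<Longrightarrow>
      distr (uniform_measure M {\<omega>\<in>space M. X (k - 1) \<omega> = x}) (count_space UNIV) (U k) =
        measure_pmf (binomial_pmf x a)"
    and triplet: "\<And>k. markov_triplet M (sigma_gen M (\<lambda>j \<omega>. (U j \<omega>, V j \<omega>, X j \<omega>)) {..k - 1})
      (sigma_gen M X {k - 1}) (sigma_gen M U {k})"
    and innovation: "\<And>k. distr M (count_space UNIV) (V k) = measure_pmf (poisson_pmf l)"
    and indep: "\<And>k. indep_set (sets (sigma_gen M V {k}))
      (sets (sigma_join M (sigma_gen M (\<lambda>j \<omega>. (U j \<omega>, V j \<omega>, X j \<omega>)) {..k - 1}) (sigma_gen M U {k})))"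
begin

abbreviation past :: "int \<Rightarrow> 'w measure" where
  "past k \<equiv> sigma_gen M (\<lambda>j \<omega>. (U j \<omega>, V j \<omega>, X j \<omega>)) {..k}"

lemma past_subalgebra: "subalgebra M (past k)"
  using triplet[of "k + 1"] by (simp add: markov_triplet_def)

lemma measurable_past:
  assumes "j \<le> k" shows "X j \<in> past k \<rightarrow>\<^sub>M count_space UNIV"
proof (rule measurableI)
  fix B :: "nat set"
  have "X j -` B \<inter> space M = (\<lambda>\<omega>. (U j \<omega>, V j \<omega>, X j \<omega>)) -` (UNIV \<times> UNIV \<times> B) \<inter> space M" by auto
  then show "X j -` B \<inter> space (past k) \<in> sets (past k)"
    using assms unfolding sets_sigma_gen space_sigma_gen by blast
qed auto

lemma thinning_prob:
  "prob {\<omega>\<in>space M. X (k - 1) \<omega> = x \<and> U k \<omega> = u} =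
    pmf (binomial_pmf x a) u * prob {\<omega>\<in>space M. X (k - 1) \<omega> = x}"
proof (cases "prob {\<omega>\<in>space M. X (k - 1) \<omega> = x} = 0")
  case True
  have "{\<omega>\<in>space M. X (k - 1) \<omega> = x} \<in> events" using meas(1) by simp
  then have "prob {\<omega>\<in>space M. X (k - 1) \<omega> = x \<and> U k \<omega> = u} \<le> prob {\<omega>\<in>space M. X (k - 1) \<omega> = x}"
    by (intro finite_measure_mono) auto
  then show ?thesis using True by (simp add: measure_le_0_iff)
next
  case False
  let ?A = "{\<omega>\<in>space M. X (k - 1) \<omega> = x}"
  have A: "?A \<in> events" using meas(1) by simp
  have pos: "0 < prob ?A" using False by (simp add: zero_less_measure_iff)
  have "pmf (binomial_pmf x a) u = measure (distr (uniform_measure M ?A) (count_space UNIV) (U k)) {u}"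
    unfolding thinning[OF pos] by (simp add: measure_pmf_single)
  also have "\<dots> = measure (uniform_measure M ?A) (U k -` {u} \<inter> space M)"
    using meas(2)[of k] by (subst measure_distr) auto
  also have "\<dots> = prob (?A \<inter> (U k -` {u} \<inter> space M)) / prob ?A"
    using pos A measurable_sets[OF meas(2)[of k], of "{u}"]
    by (subst measure_uniform_measure) (auto simp: emeasure_eq_measure)
  also have "?A \<inter> (U k -` {u} \<inter> space M) = {\<omega>\<in>space M. X (k - 1) \<omega> = x \<and> U k \<omega> = u}" by auto
  finally show ?thesis using pos by (simp add: field_simps)
qed

text \<open>
  The \<open>\<sigma>\<close>-field of a single discrete variable cannot split a level set of that variable. Hence
  conditional expectations given this \<open>\<sigma>\<close>-field are elementary conditional expectations.
\<close>
lemma value_atom: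
  fixes Y :: "int \<Rightarrow> 'w \<Rightarrow> 'b::countable"
  assumes "B \<in> sets (sigma_gen M Y {j})"
  shows "{\<omega>\<in>space M. Y j \<omega> = x} \<subseteq> B \<or> {\<omega>\<in>space M. Y j \<omega> = x} \<inter> B = {}"
  using assms unfolding sets_sigma_gen
proof induction
  case (Basic B)
  then obtain C where "B = Y j -` C \<inter> space M" by auto
  then show ?case by (cases "x \<in> C") auto
next
  case Empty
  then show ?case by simp
next
  case (Compl B)
  then show ?case by auto
next
  case (Union B)
  show ?case
  proof (cases "\<exists>i. {\<omega>\<in>space M. Y j \<omega> = x} \<subseteq> B i")
    case True
    then show ?thesis by blast
  next
    case False
    then have "{\<omega>\<in>space M. Y j \<omega> = x} \<inter> B i = {}" for i using Union.IH[of i] by blast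
    then show ?thesis by blast
  qed
qed

text \<open>
  The binomial law of \<open>U k\<close> given \<open>X (k - 1) = x\<close> does not change if an event of the past is added
  to the condition. On the level set \<open>Q\<close> the conditional probability of \<open>F\<close> given \<open>X (k - 1)\<close> is
  the constant binomial weight, and the Markov triplet factorises the conditional probability of
  the intersection.
\<close>
lemma past_thinning_prob:
  assumes E: "E \<in> sets (past (k - 1))"
  shows "prob (E \<inter> {\<omega>\<in>space M. X (k - 1) \<omega> = x} \<inter> {\<omega>\<in>space M. U k \<omega> = u}) =
    pmf (binomial_pmf x a) u * prob (E \<inter> {\<omega>\<in>space M. X (k - 1) \<omega> = x})"
proof -
  let ?B = "sigma_gen M X {k - 1}"
  let ?c = "pmf (binomial_pmf x a) u"
  define Q where "Q = {\<omega>\<in>space M. X (k - 1) \<omega> = x}"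
  define F where "F = {\<omega>\<in>space M. U k \<omega> = u}"
  define A where "A = E \<inter> Q"
  have sub: "subalgebra M ?B" using triplet[of k] by (simp add: markov_triplet_def)
  interpret B: sigma_finite_subalgebra M ?B
    by (rule finite_measure_subalgebra_is_sigma_finite) (use sub in \<open>unfold_locales\<close>)
  have Qp: "Q \<in> sets (past (k - 1))"
    using measurable_sets[OF measurable_past[of "k - 1" "k - 1"], of "{x}"]
    by (auto simp: Q_def vimage_def Int_def conj_commute)
  have A: "A \<in> sets (past (k - 1))" unfolding A_def using E Qp by blast
  have QB: "Q \<in> sets ?B" unfolding sets_sigma_gen Q_def
    by (rule sigma_sets.Basic) (auto intro!: exI[of _ "{x}"])
  have FU: "F \<in> sets (sigma_gen M U {k})" unfolding sets_sigma_gen F_def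
    by (rule sigma_sets.Basic) (auto intro!: exI[of _ "{u}"])
  have ev: "Q \<in> events" "F \<in> events" "A \<in> events"
    using QB sub FU triplet[of k] A past_subalgebra[of "k - 1"] by (auto simp: markov_triplet_def subalgebra_def)
  have [measurable]: "indicator Q \<in> borel_measurable ?B" using QB by simp
  have int: "integrable M (indicator C :: 'w \<Rightarrow> real)" if "C \<in> events" for C
    using that by (simp add: emeasure_eq_measure)
  have intQF: "integrable M (\<lambda>\<omega>. indicat_real Q \<omega> * indicat_real F \<omega>)"
    unfolding indicator_inter_arith[symmetric] by (intro int sets.Int ev)
  have PQF: "prob (Q \<inter> F) = ?c * prob Q"
    using thinning_prob[of k x u] by (simp add: Q_def F_def Int_def conj_ac) 
  \<comment> \<open>on \<open>Q\<close>, the conditional probability of \<open>F\<close> is the constant binomial weight\<close>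
  have "AE \<omega> in M. real_cond_exp M ?B (\<lambda>\<omega>. indicat_real Q \<omega> * indicat_real F \<omega>) \<omega> = ?c * indicat_real Q \<omega>"
  proof (rule B.real_cond_exp_charact)
    fix C assume C: "C \<in> sets ?B"
    have Cev: "C \<in> events" using C sub by (auto simp: subalgebra_def)
    have "(\<integral>\<omega>\<in>C. indicat_real Q \<omega> * indicat_real F \<omega> \<partial>M) = (\<integral>\<omega>. indicat_real (C \<inter> (Q \<inter> F)) \<omega> \<partial>M)"
      unfolding set_lebesgue_integral_def by (intro Bochner_Integration.integral_cong) (auto simp: indicator_def)
    also have "\<dots> = prob (C \<inter> (Q \<inter> F))" using Cev ev by (simp add: integral_indicator emeasure_eq_measure)
    also have "\<dots> = ?c * prob (C \<inter> Q)"
    proof -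
      from value_atom[OF C, of x] consider "Q \<subseteq> C" | "Q \<inter> C = {}" unfolding Q_def by blast
      then show ?thesis
      proof cases
        case 1
        then have "C \<inter> (Q \<inter> F) = Q \<inter> F" "C \<inter> Q = Q" by auto
        then show ?thesis using PQF by simp
      next
        case 2
        then have "C \<inter> (Q \<inter> F) = {}" "C \<inter> Q = {}" by auto
        then show ?thesis by simp
      qed
    qed
    also have "\<dots> = ?c * (\<integral>\<omega>. indicat_real (C \<inter> Q) \<omega> \<partial>M)" using Cev ev by (simp add: emeasure_eq_measure)
    also have "\<dots> = (\<integral>\<omega>. ?c * indicat_real (C \<inter> Q) \<omega> \<partial>M)" by simp
    also have "\<dots> = (\<integral>\<omega>\<in>C. ?c * indicat_real Q \<omega> \<partial>M)"
      unfolding set_lebesgue_integral_def by (intro Bochner_Integration.integral_cong) (auto simp: indicator_def)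
    finally show "(\<integral>\<omega>\<in>C. indicat_real Q \<omega> * indicat_real F \<omega> \<partial>M) = (\<integral>\<omega>\<in>C. ?c * indicat_real Q \<omega> \<partial>M)" .
  next
    show "integrable M (\<lambda>\<omega>. indicat_real Q \<omega> * indicat_real F \<omega> :: real)"
      by (rule intQF)
    show "integrable M (\<lambda>\<omega>. ?c * indicat_real Q \<omega>)" using int[OF ev(1)] by simp
  qed simp
  moreover have "AE \<omega> in M. real_cond_exp M ?B (\<lambda>\<omega>. indicat_real Q \<omega> * indicat_real F \<omega>) \<omega> =
      indicator Q \<omega> * real_cond_exp M ?B (indicat_real F) \<omega>"
    by (rule B.real_cond_exp_mult) (use intQF ev in auto)
  moreover have "AE \<omega> in M. real_cond_exp M ?B (indicat_real (A \<inter> F)) \<omega> =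
      real_cond_exp M ?B (indicat_real A) \<omega> * real_cond_exp M ?B (indicat_real F) \<omega>"
    using triplet[of k] A FU by (simp add: markov_triplet_def)
  ultimately have ae: "AE \<omega> in M. indicator Q \<omega> * real_cond_exp M ?B (indicat_real (A \<inter> F)) \<omega> =
      ?c * (indicator Q \<omega> * real_cond_exp M ?B (indicat_real A) \<omega>)"
    by eventually_elim auto
  have restrict: "(\<integral>\<omega>. indicat_real Q \<omega> * real_cond_exp M ?B (indicat_real C) \<omega> \<partial>M) = prob C"
    if "C \<in> events" "C \<subseteq> Q" for C
  proof -
    have i: "integrable M (\<lambda>\<omega>. indicat_real Q \<omega> * indicat_real C \<omega> :: real)"
      unfolding indicator_inter_arith[symmetric] by (intro int sets.Int ev that)
    have "(\<integral>\<omega>. indicat_real Q \<omega> * real_cond_exp M ?B (indicat_real C) \<omega> \<partial>M) =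
      (\<integral>\<omega>. indicat_real Q \<omega> * indicator C \<omega> \<partial>M)"
      by (rule B.real_cond_exp_intg(2)[OF i]) (use that in auto)
    also have "\<dots> = (\<integral>\<omega>. indicat_real C \<omega> \<partial>M)"
      using that by (intro Bochner_Integration.integral_cong) (auto simp: indicator_def)
    finally show ?thesis using that by (simp add: emeasure_eq_measure)
  qed
  have "prob (A \<inter> F) = (\<integral>\<omega>. indicat_real Q \<omega> * real_cond_exp M ?B (indicat_real (A \<inter> F)) \<omega> \<partial>M)"
    by (rule restrict[symmetric]) (use ev in \<open>auto simp: A_def\<close>)
  also have "\<dots> = (\<integral>\<omega>. ?c * (indicator Q \<omega> * real_cond_exp M ?B (indicat_real A) \<omega>) \<partial>M)"
    by (rule integral_cong_AE) (use ae ev in auto)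
  also have "\<dots> = ?c * prob A"
    using restrict[of A] ev by (simp add: A_def)
  finally show ?thesis by (simp add: A_def Q_def F_def)
qed

lemma power_integrable:
  fixes Y :: "'w \<Rightarrow> nat"
  assumes "Y \<in> M \<rightarrow>\<^sub>M count_space UNIV" "0 \<le> s" "s \<le> 1"
  shows "integrable M (\<lambda>\<omega>. s ^ Y \<omega> :: real)"
proof (rule integrable_const_bound[of _ 1])
  show "(\<lambda>\<omega>. s ^ Y \<omega>) \<in> borel_measurable M" using assms(1) by (rule measurable_compose) simp
qed (use assms in \<open>auto simp: power_le_one\<close>)

lemma atom_thinning_pgf:
  fixes x :: nat
  assumes E: "E \<in> sets (past (k - 1))" and s: "0 \<le> s" "s \<le> 1"
  defines "A \<equiv> E \<inter> {\<omega>\<in>space M. X (k - 1) \<omega> = x}"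
  shows "(\<integral>\<omega>\<in>A. s ^ U k \<omega> \<partial>M) = (1 - a + a * s) ^ x * prob A"
proof -
  have A: "A \<in> events"
    using E past_subalgebra[of "k - 1"] meas(1) by (auto simp: A_def subalgebra_def)
  have sm: "(\<lambda>\<omega>. s ^ U k \<omega>) \<in> borel_measurable M" using meas(2)[of k] by (rule measurable_compose) simp
  show ?thesis
  proof (cases "prob A = 0")
    case True
    then have "AE \<omega> in M. \<omega> \<notin> A" using A by (simp add: AE_iff_measurable[OF A] emeasure_eq_measure AE_not_in null_sets_def)
    then have "AE \<omega> in M. indicator A \<omega> *\<^sub>R s ^ U k \<omega> = 0" by eventually_elim simp
    then have "(\<integral>\<omega>\<in>A. s ^ U k \<omega> \<partial>M) = 0"
      unfolding set_lebesgue_integral_def by (rule integral_eq_zero_AE)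
    then show ?thesis using True by simp
  next
    case False
    then have pos: "0 < prob A" by (simp add: zero_less_measure_iff)
    let ?u = "uniform_measure M A"
    have eq: "distr ?u (count_space UNIV) (U k) = measure_pmf (binomial_pmf x a)"
    proof (rule measure_eqI_countable[of _ UNIV])
      fix u :: nat
      interpret u: prob_space ?u using pos by (intro prob_space_uniform_measure) (auto simp: emeasure_eq_measure A)
      have F: "U k -` {u} \<inter> space M \<in> events" using measurable_sets[OF meas(2)[of k], of "{u}"] by simp
      have "emeasure (distr ?u (count_space UNIV) (U k)) {u} = emeasure ?u (U k -` {u} \<inter> space M)"
        using meas(2)[of k] by (subst emeasure_distr) auto
      also have "\<dots> = ennreal (prob (A \<inter> (U k -` {u} \<inter> space M)) / prob A)"
        using A F pos by (subst emeasure_uniform_measure) (auto simp: emeasure_eq_measure divide_ennreal)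
      also have "A \<inter> (U k -` {u} \<inter> space M) = E \<inter> {\<omega>\<in>space M. X (k - 1) \<omega> = x} \<inter> {\<omega>\<in>space M. U k \<omega> = u}"
        by (auto simp: A_def)
      also have "prob \<dots> = pmf (binomial_pmf x a) u * prob A"
        unfolding A_def by (rule past_thinning_prob[OF E])
      finally show "emeasure (distr ?u (count_space UNIV) (U k)) {u} = emeasure (measure_pmf (binomial_pmf x a)) {u}"
        using pos by (simp add: emeasure_pmf_single)
    qed auto
    have "(1 - a + a * s) ^ x = (\<integral>n. s ^ n \<partial>distr ?u (count_space UNIV) (U k))"
      unfolding eq binomial_pgf[OF a] ..
    also have "\<dots> = (\<integral>\<omega>. s ^ U k \<omega> \<partial>?u)"
      using meas(2)[of k] by (subst integral_distr) auto
    also have "?u = density M (\<lambda>\<omega>. ennreal (indicator A \<omega> / prob A))"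
      unfolding uniform_measure_def
      using pos by (intro density_cong) (use A in \<open>auto simp: emeasure_eq_measure divide_ennreal[symmetric] split: split_indicator\<close>)
    also have "(\<integral>\<omega>. s ^ U k \<omega> \<partial>\<dots>) = (\<integral>\<omega>. (indicator A \<omega> / prob A) *\<^sub>R s ^ U k \<omega> \<partial>M)"
      using A sm by (subst integral_density) auto
    also have "\<dots> = (\<integral>\<omega>\<in>A. s ^ U k \<omega> \<partial>M) / prob A"
      unfolding set_lebesgue_integral_def by simp
    finally show ?thesis using pos by (simp add: field_simps)
  qed
qed

text \<open>
  Summation over the possible values of \<open>X (k - 1)\<close>. In other words, the conditional expectation
  of \<open>s ^ U k\<close> given the past is \<open>(1 - a + a s) ^ X (k - 1)\<close>.
\<close>
lemma past_thinning_pgf: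
  assumes E: "E \<in> sets (past (k - 1))" and s: "0 \<le> s" "s \<le> 1"
  shows "(\<integral>\<omega>\<in>E. s ^ U k \<omega> \<partial>M) = (\<integral>\<omega>\<in>E. (1 - a + a * s) ^ X (k - 1) \<omega> \<partial>M)"
proof -
  let ?A = "\<lambda>x. E \<inter> {\<omega>\<in>space M. X (k - 1) \<omega> = x}"
  let ?r = "1 - a + a * s"
  have "a * s \<le> a * 1" using a s by (intro mult_left_mono) auto
  then have r: "0 \<le> ?r" "?r \<le> 1" using a s by auto
  have Em: "E \<in> events" using E past_subalgebra[of "k - 1"] by (auto simp: subalgebra_def)
  have A: "?A x \<in> events" for x using Em meas(1) by auto
  have un: "E = (\<Union>x. ?A x)" using sets.sets_into_space[OF Em] by auto
  have countable: "(\<integral>\<omega>\<in>E. f \<omega> \<partial>M) = (\<Sum>x. \<integral>\<omega>\<in>?A x. f \<omega> \<partial>M)" if "integrable M f" for f :: "'w \<Rightarrow> real"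
  proof -
    have "set_integrable M (\<Union>x. ?A x) f"
      unfolding un[symmetric] set_integrable_def by (rule integrable_mult_indicator[OF Em that])
    then have "(\<integral>\<omega>\<in>(\<Union>x. ?A x). f \<omega> \<partial>M) = (\<Sum>x. \<integral>\<omega>\<in>?A x. f \<omega> \<partial>M)"
      by (intro lebesgue_integral_countable_add A) auto
    then show ?thesis unfolding un[symmetric] .
  qed
  have "(\<integral>\<omega>\<in>?A x. s ^ U k \<omega> \<partial>M) = (\<integral>\<omega>\<in>?A x. ?r ^ X (k - 1) \<omega> \<partial>M)" for x
  proof -
    have "(\<integral>\<omega>\<in>?A x. ?r ^ X (k - 1) \<omega> \<partial>M) = (\<integral>\<omega>\<in>?A x. ?r ^ x \<partial>M)"
      by (rule set_lebesgue_integral_cong) (use A in auto)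
    also have "\<dots> = ?r ^ x * prob (?A x)"
      using A[of x] unfolding set_lebesgue_integral_def by (simp add: emeasure_eq_measure)
    finally show ?thesis using atom_thinning_pgf[OF E s] by simp
  qed
  then show ?thesis
    using countable[OF power_integrable[OF meas(2) s]] countable[OF power_integrable[OF meas(1) r]] by simp
qed

end

section \<open>Joint generating functions of the process\<close>

context poisson_inar
begin

lemma thinning_argument:
  assumes "0 \<le> s" "s \<le> 1" shows "0 \<le> 1 - a + a * s" "1 - a + a * s \<le> 1"
proof -
  have "a * s \<le> a * 1" using a assms by (intro mult_left_mono) auto
  then show "0 \<le> 1 - a + a * s" "1 - a + a * s \<le> 1" using a assms by auto
qed

lemma thinning_expectation:
  assumes W: "W \<in> borel_measurable (past (k - 1))" "\<And>\<omega>. \<omega> \<in> space M \<Longrightarrow> \<bar>W \<omega>\<bar> \<le> 1"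
    and s: "0 \<le> s" "s \<le> 1"
  shows "(\<integral>\<omega>. W \<omega> * s ^ U k \<omega> \<partial>M) = (\<integral>\<omega>. W \<omega> * (1 - a + a * s) ^ X (k - 1) \<omega> \<partial>M)"
proof -
  let ?P = "past (k - 1)" and ?r = "1 - a + a * s"
  note r = thinning_argument[OF s]
  interpret P: sigma_finite_subalgebra M ?P
    by (rule finite_measure_subalgebra_is_sigma_finite)
       (use past_subalgebra[of "k - 1"] in \<open>unfold_locales\<close>)
  have Wm: "W \<in> borel_measurable M" by (rule measurable_from_subalg[OF past_subalgebra W(1)])
  have intU: "integrable M (\<lambda>\<omega>. s ^ U k \<omega>)" and intX: "integrable M (\<lambda>\<omega>. ?r ^ X (k - 1) \<omega>)"
    using power_integrable[OF meas(2) s] power_integrable[OF meas(1) r] by auto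
  have rm: "(\<lambda>\<omega>. ?r ^ X (k - 1) \<omega>) \<in> borel_measurable ?P"
    using measurable_past[of "k - 1" "k - 1"] by (rule measurable_compose) simp_all
  have ce: "AE \<omega> in M. real_cond_exp M ?P (\<lambda>\<omega>. s ^ U k \<omega>) \<omega> = ?r ^ X (k - 1) \<omega>"
    by (rule P.real_cond_exp_charact[OF _ intU intX rm]) (rule past_thinning_pgf[OF _ s])
  have "integrable M (\<lambda>\<omega>. W \<omega> * s ^ U k \<omega>)"
  proof (rule Bochner_Integration.integrable_bound[OF intU])
    show "AE \<omega> in M. norm (W \<omega> * s ^ U k \<omega>) \<le> norm (s ^ U k \<omega>)"
      using W(2) s by (intro AE_I2) (simp add: abs_mult mult_left_le_one_le)
  qed (use Wm intU in auto)
  from P.real_cond_exp_intg(2)[OF this W(1)] intU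
  have "(\<integral>\<omega>. W \<omega> * s ^ U k \<omega> \<partial>M) = (\<integral>\<omega>. W \<omega> * real_cond_exp M ?P (\<lambda>\<omega>. s ^ U k \<omega>) \<omega> \<partial>M)"
    by auto
  also have "\<dots> = (\<integral>\<omega>. W \<omega> * ?r ^ X (k - 1) \<omega> \<partial>M)"
    by (rule integral_cong_AE)
       (use ce Wm intX measurable_from_subalg[OF past_subalgebra rm] in auto)
  finally show ?thesis .
qed

text \<open>
  One step of the process: the survivors contribute the thinned power of \<open>X (k - 1)\<close>, and the
  immigrants are independent of the past and of the survivors and contribute the Poisson
  generating function.
\<close>
lemma transition_expectation:
  assumes W: "W \<in> borel_measurable (past (k - 1))" "\<And>\<omega>. \<omega> \<in> space M \<Longrightarrow> \<bar>W \<omega>\<bar> \<le> 1"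
    and s: "0 \<le> s" "s \<le> 1"
  shows "(\<integral>\<omega>. W \<omega> * s ^ X k \<omega> \<partial>M) =
    (\<integral>\<omega>. W \<omega> * (1 - a + a * s) ^ X (k - 1) \<omega> \<partial>M) * exp (l * (s - 1))"
proof -
  let ?V = "sigma_gen M V {k}" and ?J = "sigma_join M (past (k - 1)) (sigma_gen M U {k})"
  have subU: "sets (sigma_gen M U {k}) \<subseteq> events" and subP: "sets (past (k - 1)) \<subseteq> events"
    using triplet[of k] by (auto simp: markov_triplet_def subalgebra_def)
  have J: "sets ?J = sigma_sets (space M) (sets (past (k - 1)) \<union> sets (sigma_gen M U {k}))" "space ?J = space M"
    unfolding sigma_join_def using subU subP sets.space_closed[of M]
    by (subst sets_measure_of space_measure_of; blast)+
  have sgP: "subalgebra ?J (past (k - 1))" and sgU: "subalgebra ?J (sigma_gen M U {k})"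
    unfolding subalgebra_def J by auto
  have own: "Y k \<in> sigma_gen M Y {k} \<rightarrow>\<^sub>M count_space UNIV" for Y :: "int \<Rightarrow> 'w \<Rightarrow> nat"
    by (rule measurableI) (auto simp: sets_sigma_gen)
  define W' where "W' \<omega> = W \<omega> * s ^ U k \<omega>" for \<omega>
  have W'J: "W' \<in> borel_measurable ?J"
  proof -
    have "(\<lambda>\<omega>. s ^ U k \<omega>) \<in> borel_measurable (sigma_gen M U {k})"
      using own[of U] by (rule measurable_compose) simp
    from measurable_from_subalg[OF sgU this] measurable_from_subalg[OF sgP W(1)]
    show ?thesis unfolding W'_def by simp
  qed
  have sV: "(\<lambda>\<omega>. s ^ V k \<omega>) \<in> borel_measurable ?V"
    using own[of V] by (rule measurable_compose) simp
  have JM: "subalgebra M ?J" and VM: "subalgebra M ?V"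
    using indep[of k] unfolding indep_set_def by (auto simp: indep_sets_def subalgebra_def J(2) split: bool.splits)
  have "indep_var borel (\<lambda>\<omega>. s ^ V k \<omega>) borel W'"
    unfolding indep_var_eq
  proof (intro conjI indep_setI)
    show "(\<lambda>\<omega>. s ^ V k \<omega>) \<in> borel_measurable M" by (rule measurable_from_subalg[OF VM sV])
    show "W' \<in> borel_measurable M" by (rule measurable_from_subalg[OF JM W'J])
    have 1: "sigma_sets (space M) {(\<lambda>\<omega>. s ^ V k \<omega>) -` A \<inter> space M | A. A \<in> sets borel} \<subseteq> sets ?V"
      by (rule sets.sigma_sets_subset[of _ ?V, unfolded space_sigma_gen])
         (use measurable_sets[OF sV] in auto)
    have 2: "sigma_sets (space M) {W' -` A \<inter> space M | A. A \<in> sets borel} \<subseteq> sets ?J"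
      by (rule sets.sigma_sets_subset[of _ ?J, unfolded J(2)])
         (use measurable_sets[OF W'J] J(2) in auto)
    show "sigma_sets (space M) {(\<lambda>\<omega>. s ^ V k \<omega>) -` A \<inter> space M | A. A \<in> sets borel} \<subseteq> events"
      using 1 VM by (auto simp: subalgebra_def)
    show "sigma_sets (space M) {W' -` A \<inter> space M | A. A \<in> sets borel} \<subseteq> events"
      using 2 JM by (auto simp: subalgebra_def)
    show "prob (A \<inter> B) = prob A * prob B"
      if "A \<in> sigma_sets (space M) {(\<lambda>\<omega>. s ^ V k \<omega>) -` A \<inter> space M | A. A \<in> sets borel}"
        "B \<in> sigma_sets (space M) {W' -` A \<inter> space M | A. A \<in> sets borel}" for A B
      using indep_setD[OF indep[of k]] 1 2 that by blast
  qed
  moreover have "integrable M W'"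
  proof (rule integrable_const_bound[of _ 1])
    show "AE \<omega> in M. norm (W' \<omega>) \<le> 1"
      using W(2) s by (intro AE_I2) (auto simp: W'_def abs_mult power_le_one intro!: mult_le_one)
    show "W' \<in> borel_measurable M" by (rule measurable_from_subalg[OF JM W'J])
  qed
  ultimately have "(\<integral>\<omega>. s ^ V k \<omega> * W' \<omega> \<partial>M) = (\<integral>\<omega>. s ^ V k \<omega> \<partial>M) * (\<integral>\<omega>. W' \<omega> \<partial>M)"
    by (intro indep_var_lebesgue_integral power_integrable meas s)
  moreover have "(\<integral>\<omega>. W \<omega> * s ^ X k \<omega> \<partial>M) = (\<integral>\<omega>. s ^ V k \<omega> * W' \<omega> \<partial>M)"
    by (intro Bochner_Integration.integral_cong refl) (simp add: W'_def decomposition power_add)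
  moreover have "(\<integral>\<omega>. s ^ V k \<omega> \<partial>M) = exp (l * (s - 1))"
  proof -
    have "(\<integral>\<omega>. s ^ V k \<omega> \<partial>M) = (\<integral>n. s ^ n \<partial>distr M (count_space UNIV) (V k))"
      using meas(3)[of k] by (subst integral_distr) auto
    then show ?thesis unfolding innovation using poisson_pgf[OF l s(1)] by simp
  qed
  moreover have "(\<integral>\<omega>. W' \<omega> \<partial>M) = (\<integral>\<omega>. W \<omega> * (1 - a + a * s) ^ X (k - 1) \<omega> \<partial>M)"
    unfolding W'_def by (rule thinning_expectation[OF W s])
  ultimately show ?thesis by simp
qed

lemma stationary_pgf:
  fixes s :: real
  shows "(\<integral>\<omega>. s ^ X k \<omega> \<partial>M) = (\<integral>\<omega>. s ^ X 0 \<omega> \<partial>M)"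
proof -
  let ?N = "\<Pi>\<^sub>M j\<in>{0::int}. count_space (UNIV :: nat set)"
  have m: "(\<lambda>\<omega>. \<lambda>j\<in>{0}. X (j + i) \<omega>) \<in> M \<rightarrow>\<^sub>M ?N" for i
    using meas(1) by (intro measurable_restrict) auto
  have eq: "distr M ?N (\<lambda>\<omega>. \<lambda>j\<in>{0}. X (j + k) \<omega>) = distr M ?N (\<lambda>\<omega>. \<lambda>j\<in>{0}. X j \<omega>)"
    using stationary unfolding strictly_stationary_def by blast
  have b: "(\<lambda>x. s ^ x 0) \<in> borel_measurable ?N"
    by (rule measurable_compose[OF measurable_component_singleton]) auto
  have "(\<integral>\<omega>. s ^ X i \<omega> \<partial>M) = (\<integral>x. s ^ x 0 \<partial>distr M ?N (\<lambda>\<omega>. \<lambda>j\<in>{0}. X (j + i) \<omega>))" for i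
    by (subst integral_distr[OF m b]) simp
  from this[of k] this[of 0] eq show ?thesis by simp
qed

text \<open>
  By stationarity the one-step recursion is a functional equation for the generating function of
  the marginal law. Iterating it moves the argument \<open>s\<close> along \<open>1 - a\<^sup>n (1 - s)\<close> to \<open>1\<close>, where
  every generating function is continuous with value \<open>1\<close>; so the marginal law is Poisson with
  mean \<open>l / (1 - a)\<close>.
\<close>
lemma marginal_pgf:
  assumes s: "0 \<le> s" "s \<le> 1"
  shows "(\<integral>\<omega>. s ^ X k \<omega> \<partial>M) = exp (l / (1 - a) * (s - 1))"
proof -
  define G where "G s = (\<integral>\<omega>. s ^ X 0 \<omega> \<partial>M)" for s :: real
  \<comment> \<open>the iterates of \<open>s \<mapsto> 1 - a + a s\<close>\<close>
  define t where "t n = 1 - a ^ n * (1 - s)" for n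
  have t01: "0 \<le> t n" "t n \<le> 1" for n
  proof -
    have "a ^ n * (1 - s) \<le> 1" using a s by (intro mult_le_one power_le_one) auto
    moreover have "0 \<le> a ^ n * (1 - s)" using a s by auto
    ultimately show "0 \<le> t n" "t n \<le> 1" by (auto simp: t_def)
  qed
  have step: "G (t n) = G (t (Suc n)) * exp (l * (t n - 1))" for n
  proof -
    have "t (Suc n) = 1 - a + a * t n" by (simp add: t_def algebra_simps)
    then show ?thesis
      using transition_expectation[of "\<lambda>_. 1" 0 "t n"] t01[of n] stationary_pgf[of _ "- 1"] by (simp add: G_def)
  qed
  have G: "G s = G (t n) * exp (l / (1 - a) * (s - t n))" for n
  proof (induction n)
    case 0
    then show ?case by (simp add: t_def)
  next
    case (Suc n)
    have "t n - t (Suc n) = (1 - a) * (t n - 1)" by (simp add: t_def algebra_simps)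
    then have "l * (t n - 1) = l / (1 - a) * (t n - t (Suc n))" using a by simp
    then have "l * (t n - 1) + l / (1 - a) * (s - t n) = l / (1 - a) * (s - t (Suc n))"
      by (simp only: distrib_left[symmetric]) simp
    then show ?case using Suc step[of n] by (simp add: exp_add[symmetric] mult.assoc)
  qed
  have t1: "t \<longlonglongrightarrow> 1"
  proof -
    have "(\<lambda>n. 1 - a ^ n * (1 - s)) \<longlonglongrightarrow> 1 - 0 * (1 - s)"
      using a by (intro tendsto_intros LIMSEQ_power_zero) auto
    then show ?thesis by (simp add: t_def[abs_def])
  qed
  have "(\<lambda>n. G (t n)) \<longlonglongrightarrow> (\<integral>\<omega>. 1 \<partial>M)"
    unfolding G_def
  proof (rule integral_dominated_convergence[where w = "\<lambda>_. 1"])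
    show "AE \<omega> in M. (\<lambda>n. t n ^ X 0 \<omega>) \<longlonglongrightarrow> 1"
    proof (rule AE_I2)
      fix \<omega>
      from tendsto_power[OF t1, of "X 0 \<omega>"] show "(\<lambda>n. t n ^ X 0 \<omega>) \<longlonglongrightarrow> 1" by simp
    qed
    show "AE \<omega> in M. norm (t n ^ X 0 \<omega>) \<le> 1" for n
      using t01[of n] by (intro AE_I2) (simp add: power_le_one)
    show "(\<lambda>\<omega>. t n ^ X 0 \<omega>) \<in> borel_measurable M" for n
      using power_integrable[OF meas(1) t01] by blast
  qed auto
  then have "(\<lambda>n. G (t n) * exp (l / (1 - a) * (s - t n))) \<longlonglongrightarrow> 1 * exp (l / (1 - a) * (s - 1))"
    by (intro tendsto_intros t1) (simp_all add: prob_space)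
  then have "(\<lambda>n. G s) \<longlonglongrightarrow> exp (l / (1 - a) * (s - 1))" using G by simp
  then have "G s = exp (l / (1 - a) * (s - 1))" by (simp add: LIMSEQ_const_iff)
  then show ?thesis using stationary_pgf[of s k] by (simp add: G_def)
qed

text \<open>
  The finite-dimensional laws are those of the counts of a Poisson process of lifetimes. The
  last time is integrated out by the transition formula, which changes the argument at time \<open>q\<close> as in
  the recursion for \<open>log_pgf\<close>.
\<close>
lemma window_pgf:
  assumes "p \<le> q" and s: "\<And>k. 0 \<le> s k \<and> s k \<le> 1"
  shows "(\<integral>\<omega>. (\<Prod>k\<in>{p..q}. s k ^ X k \<omega>) \<partial>M) = exp (log_pgf a l p q s)"
  using assms
proof (induction q arbitrary: s rule: int_ge_induct)
  case base
  then show ?case by (simp add: marginal_pgf log_pgf_single)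
next
  case (step q)
  let ?r = "1 - a + a * s (q + 1)"
  let ?s' = "s(q := s q * ?r)"
  have r: "0 \<le> ?r" "?r \<le> 1" using thinning_argument[of "s (q + 1)"] step.prems by auto
  have W: "(\<lambda>\<omega>. \<Prod>k\<in>{p..q}. s k ^ X k \<omega>) \<in> borel_measurable (past (q + 1 - 1))"
    by (intro borel_measurable_prod measurable_compose[OF measurable_past]) auto
  have W1: "\<bar>\<Prod>k\<in>{p..q}. s k ^ X k \<omega>\<bar> \<le> 1" for \<omega>
    using step.prems by (auto simp: abs_prod intro!: prod_le_1 power_le_one)
  have split: "{p..q + 1} = insert (q + 1) {p..q}" "{p..q} = insert q {p..q - 1}" using step.hyps by auto
  have "(\<integral>\<omega>. (\<Prod>k\<in>{p..q + 1}. s k ^ X k \<omega>) \<partial>M) =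
    (\<integral>\<omega>. (\<Prod>k\<in>{p..q}. s k ^ X k \<omega>) * s (q + 1) ^ X (q + 1) \<omega> \<partial>M)"
    unfolding split(1) by (simp add: mult.commute)
  also have "\<dots> = (\<integral>\<omega>. (\<Prod>k\<in>{p..q}. s k ^ X k \<omega>) * ?r ^ X q \<omega> \<partial>M) * exp (l * (s (q + 1) - 1))"
    using transition_expectation[OF W W1, of "s (q + 1)"] step.prems by simp
  also have "(\<integral>\<omega>. (\<Prod>k\<in>{p..q}. s k ^ X k \<omega>) * ?r ^ X q \<omega> \<partial>M) = (\<integral>\<omega>. (\<Prod>k\<in>{p..q}. ?s' k ^ X k \<omega>) \<partial>M)"
  proof (intro Bochner_Integration.integral_cong refl)
    fix \<omega>
    have "(\<Prod>k\<in>{p..q - 1}. ?s' k ^ X k \<omega>) = (\<Prod>k\<in>{p..q - 1}. s k ^ X k \<omega>)" by (intro prod.cong) auto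
    then show "(\<Prod>k\<in>{p..q}. s k ^ X k \<omega>) * ?r ^ X q \<omega> = (\<Prod>k\<in>{p..q}. ?s' k ^ X k \<omega>)"
      unfolding split(2) by (simp add: power_mult_distrib)
  qed
  also have "\<dots> = exp (log_pgf a l p q ?s')"
    by (rule step.IH) (use step.prems r in \<open>auto intro: mult_le_one\<close>)
  also have "\<dots> * exp (l * (s (q + 1) - 1)) = exp (log_pgf a l p (q + 1) s)"
    unfolding log_pgf_extend[OF step.hyps] by (simp add: exp_add mult.commute)
  finally show ?case .
qed

end

text \<open>
  A representation of \<open>f\<close> that is valid over every window containing \<open>J\<close>, so that two
  functions can be expanded over a common window. The arguments equal \<open>1\<close> off \<open>S\<close>, and
  hence their charges depend only on the points of \<open>S\<close> in an interval.
\<close>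
definition window_expansion ::
  "(int \<Rightarrow> 'w \<Rightarrow> nat) \<Rightarrow> int set \<Rightarrow> ('w \<Rightarrow> real) \<Rightarrow> nat \<Rightarrow> (nat \<Rightarrow> real) \<Rightarrow> (nat \<Rightarrow> int \<Rightarrow> real) \<Rightarrow> int set \<Rightarrow> bool"
  where
  "window_expansion X S f n c s J \<longleftrightarrow> finite J \<and>
    (\<forall>i k. 0 \<le> s i k \<and> s i k \<le> 1) \<and> (\<forall>i k. k \<notin> S \<longrightarrow> s i k = 1) \<and>
    (\<forall>J' \<omega>. finite J' \<longrightarrow> J \<subseteq> J' \<longrightarrow> f \<omega> = (\<Sum>i<n. c i * (\<Prod>k\<in>J'. s i k ^ X k \<omega>)))"

lemma power_span_window_expansion:
  assumes "f \<in> power_span X S"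
  shows "\<exists>n c s J. window_expansion X S f n c s J"
  using assms
proof induction
  case (power J s)
  let ?s = "\<lambda>(i::nat) k. if k \<in> J then s k else 1"
  have "(\<Prod>k\<in>J. s k ^ X k \<omega>) = (\<Prod>k\<in>J'. ?s 0 k ^ X k \<omega>)"
    if "finite J'" "J \<subseteq> J'" for J' \<omega>
    using that by (intro prod.mono_neutral_cong_left) auto
  then have "window_expansion X S (\<lambda>\<omega>. \<Prod>k\<in>J. s k ^ X k \<omega>) 1 (\<lambda>_. 1) ?s J"
    using power unfolding window_expansion_def by auto
  then show ?case by blast
next
  case (add f g)
  obtain n c s J where f: "window_expansion X S f n c s J" using add.IH(1) by blast
  obtain m d t K where g: "window_expansion X S g m d t K" using add.IH(2) by blast
  let ?c = "\<lambda>i. if i < n then c i else d (i - n)" and ?s = "\<lambda>i. if i < n then s i else t (i - n)"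
  have concat: "(\<Sum>i<n + m. h i) = (\<Sum>i<n. h i) + (\<Sum>i<m. h (n + i))" for h :: "nat \<Rightarrow> real"
    by (induction m) auto
  have "window_expansion X S (\<lambda>\<omega>. f \<omega> + g \<omega>) (n + m) ?c ?s (J \<union> K)"
    using f g unfolding window_expansion_def concat by simp
  then show ?case by blast
next
  case (scale f c)
  obtain n d s J where "window_expansion X S f n d s J" using scale.IH by blast
  then have "window_expansion X S (\<lambda>\<omega>. c * f \<omega>) n (\<lambda>i. c * d i) s J"
    unfolding window_expansion_def by (simp add: sum_distrib_left mult.assoc)
  then show ?case by blast
qed

section \<open>Correlations across interlaced time sets\<close>

lemma interval_charge_restrict:
  assumes "\<And>k. k \<notin> S \<Longrightarrow> s k = 1"
  shows "interval_charge s (b, e) = (\<Prod>k\<in>S \<inter> {b..e}. s k) - 1"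
proof -
  have "(\<Prod>k\<in>{b..e}. s k) = (\<Prod>k\<in>S \<inter> {b..e}. s k)"
    using assms by (intro prod.mono_neutral_right) auto
  then show ?thesis by (simp add: interval_charge_def)
qed

context poisson_inar
begin

text \<open>
  Up to the factors \<open>exp (log_pgf _)\<close>, which the coefficients absorb, the expected product of two
  power products is the exponential of the inner product of their charges.
\<close>
lemma covariance_expansion:
  fixes n m :: nat and s t :: "nat \<Rightarrow> int \<Rightarrow> real"
  assumes pq: "p \<le> q" and s: "\<And>i k. 0 \<le> s i k \<and> s i k \<le> 1" and t: "\<And>i k. 0 \<le> t i k \<and> t i k \<le> 1"
    and f: "\<And>\<omega>. f \<omega> = (\<Sum>i<n. c i * (\<Prod>k\<in>{p..q}. s i k ^ X k \<omega>))"
    and g: "\<And>\<omega>. g \<omega> = (\<Sum>j<m. d j * (\<Prod>k\<in>{p..q}. t j k ^ X k \<omega>))"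
  shows "(\<integral>\<omega>. f \<omega> * g \<omega> \<partial>M) - (\<integral>\<omega>. f \<omega> \<partial>M) * (\<integral>\<omega>. g \<omega> \<partial>M) =
    (\<Sum>i<n. \<Sum>j<m. (c i * exp (log_pgf a l p q (s i))) * (d j * exp (log_pgf a l p q (t j))) *
       (exp (weighted_inner (window_intervals p q) (interval_weight a l p q)
          (interval_charge (s i)) (interval_charge (t j))) - 1))"
proof -
  let ?e = "\<lambda>s \<omega>. \<Prod>k\<in>{p..q}. (s k :: real) ^ X k \<omega>" and ?A = "log_pgf a l p q"
  let ?ip = "\<lambda>i j. weighted_inner (window_intervals p q) (interval_weight a l p q)
          (interval_charge (s i)) (interval_charge (t j))"
  have int: "integrable M (?e r)" if "\<And>k. 0 \<le> r k \<and> r k \<le> 1" for r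
  proof (rule square_integrable_integrable[OF power_span_square_integrable[of X _ UNIV]])
    show "?e r \<in> power_span X UNIV" using that by (intro power_span.power) auto
  qed (rule meas)
  have st: "0 \<le> s i k * t j k \<and> s i k * t j k \<le> 1" for i j k
    using s[of i k] t[of j k] by (auto intro: mult_le_one)
  have mult: "?e (s i) \<omega> * ?e (t j) \<omega> = ?e (\<lambda>k. s i k * t j k) \<omega>" for i j \<omega>
    by (simp add: power_mult_distrib prod.distrib)
  have "f \<omega> * g \<omega> = (\<Sum>i<n. \<Sum>j<m. c i * d j * ?e (\<lambda>k. s i k * t j k) \<omega>)" for \<omega>
    unfolding f g sum_product mult[symmetric] by (intro sum.cong refl) (simp only: mult_ac)
  then have "(\<integral>\<omega>. f \<omega> * g \<omega> \<partial>M) = (\<Sum>i<n. \<Sum>j<m. c i * d j * (\<integral>\<omega>. ?e (\<lambda>k. s i k * t j k) \<omega> \<partial>M))"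
    using int[OF st] by (simp add: Bochner_Integration.integral_sum)
  also have "\<dots> = (\<Sum>i<n. \<Sum>j<m. c i * d j * exp (?A (\<lambda>k. s i k * t j k)))"
    using st by (simp add: window_pgf[OF pq])
  also have "\<dots> = (\<Sum>i<n. \<Sum>j<m. (c i * exp (?A (s i))) * (d j * exp (?A (t j))) * exp (?ip i j))"
    unfolding log_pgf_mult by (simp add: exp_add mult_ac)
  finally have fg: "(\<integral>\<omega>. f \<omega> * g \<omega> \<partial>M) =
      (\<Sum>i<n. \<Sum>j<m. (c i * exp (?A (s i))) * (d j * exp (?A (t j))) * exp (?ip i j))" .
  have Ef: "(\<integral>\<omega>. f \<omega> \<partial>M) = (\<Sum>i<n. c i * exp (?A (s i)))"
    unfolding f using int[OF s] by (simp add: Bochner_Integration.integral_sum window_pgf[OF pq s])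
  have Eg: "(\<integral>\<omega>. g \<omega> \<partial>M) = (\<Sum>j<m. d j * exp (?A (t j)))"
    unfolding g using int[OF t] by (simp add: Bochner_Integration.integral_sum window_pgf[OF pq t])
  show ?thesis
    unfolding fg Ef Eg sum_product sum_subtractf[symmetric]
    by (simp only: right_diff_distrib mult_1_right)
qed

text \<open>
  The charges in the expansion of a function in the span over \<open>S\<close> vanish on intervals missing
  \<open>S\<close> and see only the points of \<open>S\<close>. So the contraction on intervals provides the linear case, and \<open>exp_gram_contract\<close>
  extends it to the full covariance.
\<close>
lemma span_covariance_bound:
  assumes d: "1 \<le> d" and dist: "\<And>s t. s \<in> S \<Longrightarrow> t \<in> T \<Longrightarrow> int d \<le> \<bar>s - t\<bar>"
    and f: "f \<in> power_span X S" and g: "g \<in> power_span X T"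
  shows "\<bar>(\<integral>\<omega>. f \<omega> * g \<omega> \<partial>M) - (\<integral>\<omega>. f \<omega> \<partial>M) * (\<integral>\<omega>. g \<omega> \<partial>M)\<bar> \<le>
    2 * sqrt (a ^ d / (1 - a)) *
    (sqrt ((\<integral>\<omega>. f \<omega> * f \<omega> \<partial>M) - (\<integral>\<omega>. f \<omega> \<partial>M) * (\<integral>\<omega>. f \<omega> \<partial>M)) *
     sqrt ((\<integral>\<omega>. g \<omega> * g \<omega> \<partial>M) - (\<integral>\<omega>. g \<omega> \<partial>M) * (\<integral>\<omega>. g \<omega> \<partial>M)))"
proof -
  obtain n c s J where "window_expansion X S f n c s J"
    using power_span_window_expansion[OF f] by blast
  note F = this[unfolded window_expansion_def, THEN conjunct1]
    this[unfolded window_expansion_def, THEN conjunct2, THEN conjunct1, rule_format]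
    this[unfolded window_expansion_def, THEN conjunct2, THEN conjunct2, THEN conjunct1, rule_format]
    this[unfolded window_expansion_def, THEN conjunct2, THEN conjunct2, THEN conjunct2, rule_format]
  obtain m c' t K where "window_expansion X T g m c' t K"
    using power_span_window_expansion[OF g] by blast
  note G = this[unfolded window_expansion_def, THEN conjunct1]
    this[unfolded window_expansion_def, THEN conjunct2, THEN conjunct1, rule_format]
    this[unfolded window_expansion_def, THEN conjunct2, THEN conjunct2, THEN conjunct1, rule_format]
    this[unfolded window_expansion_def, THEN conjunct2, THEN conjunct2, THEN conjunct2, rule_format]
  \<comment> \<open>the point \<open>0\<close> keeps the window nonempty when \<open>J\<close> and \<open>K\<close> are empty\<close>
  define p q where "p = Min (insert 0 (J \<union> K))" and "q = Max (insert 0 (J \<union> K))"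
  have JK: "J \<subseteq> {p..q}" "K \<subseteq> {p..q}" and "p \<le> 0" "0 \<le> q"
    using F(1) G(1) by (auto simp: p_def q_def)
  then have pq: "p \<le> q" by simp
  let ?E = "window_intervals p q" and ?w = "interval_weight a l p q" and ?\<kappa> = "2 * sqrt (a ^ d / (1 - a))"
  let ?u = "\<lambda>i. interval_charge (s i)" and ?v = "\<lambda>j. interval_charge (t j)"
  have base: "\<bar>power_gram ?E ?w {..<n} ?u {..<m} ?v 1 x y\<bar> \<le>
      ?\<kappa> * (sqrt (power_gram ?E ?w {..<n} ?u {..<n} ?u 1 x x) * sqrt (power_gram ?E ?w {..<m} ?v {..<m} ?v 1 y y))"
    for x y
  proof -
    have one: "power_gram ?E ?w I u J v 1 x y = (\<Sum>e\<in>?E. ?w e * (\<Sum>i\<in>I. x i * u i e) * (\<Sum>j\<in>J. y j * v j e))"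
      for I J :: "nat set" and u v x y
      unfolding One_nat_def power_gram_Suc power_gram_0 by (simp only: mult.assoc)
    have sq: "power_gram ?E ?w I u I u 1 x x = (\<Sum>e\<in>?E. ?w e * (\<Sum>i\<in>I. x i * u i e)\<^sup>2)"
      for I :: "nat set" and u x
      unfolding one by (simp only: power2_eq_square mult.assoc)
    have U: "interval_charge (s i) (b, e) = (\<Prod>k\<in>S \<inter> {b..e}. s i k) - 1" for i b e
      by (rule interval_charge_restrict) (rule F(3))
    have V: "interval_charge (t j) (b, e) = (\<Prod>k\<in>T \<inter> {b..e}. t j k) - 1" for j b e
      by (rule interval_charge_restrict) (rule G(3))
    show ?thesis
      unfolding one[of "{..<n}" ?u "{..<m}"] sq
    proof (rule interlaced_interval_contraction[OF a l d dist])
      show "(\<Sum>i<n. x i * ?u i (b, e)) = (\<Sum>i<n. x i * ?u i (b', e))"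
        if "S \<inter> {b..e} = S \<inter> {b'..e}" for b b' e
        unfolding U that ..
      show "(\<Sum>j<m. y j * ?v j (b, e)) = (\<Sum>j<m. y j * ?v j (b', e))"
        if "T \<inter> {b..e} = T \<inter> {b'..e}" for b b' e
        unfolding V that ..
      show "(\<Sum>i<n. x i * ?u i (b, e)) = 0" if "S \<inter> {b..e} = {}" for b e
        unfolding U that by simp
      show "(\<Sum>j<m. y j * ?v j (b, e)) = 0" if "T \<inter> {b..e} = {}" for b e
        unfolding V that by simp
    qed
  qed
  have w: "0 \<le> ?w e" for e by (rule interval_weight_nonneg[OF a l])
  have \<kappa>: "0 \<le> ?\<kappa>" using a by simp
  note F' = F(4)[OF finite_atLeastAtMost_int JK(1)] and G' = G(4)[OF finite_atLeastAtMost_int JK(2)]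
  show ?thesis
    unfolding covariance_expansion[OF pq F(2) G(2) F' G'] covariance_expansion[OF pq F(2) F(2) F' F']
      covariance_expansion[OF pq G(2) G(2) G' G']
    by (rule exp_gram_contract[OF w \<kappa> base])
qed

lemma corr_bound:
  assumes "1 \<le> d" "\<And>s t. s \<in> S \<Longrightarrow> t \<in> T \<Longrightarrow> int d \<le> \<bar>s - t\<bar>"
    and "f \<in> borel_measurable (sigma_gen M X S)" "square_integrable M f"
    and "g \<in> borel_measurable (sigma_gen M X T)" "square_integrable M g"
  shows "\<bar>corr M f g\<bar> \<le> 2 * sqrt (a ^ d / (1 - a))"
proof (rule corr_bound_from_dense)
  show "L2_approximable (power_span X S) f" "L2_approximable (power_span X T) g"
    using assms by (auto intro!: sigma_gen_L2_approximable meas)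
  show "0 \<le> 2 * sqrt (a ^ d / (1 - a))" using a by simp
qed (rule span_covariance_bound[OF assms(1,2)])

lemma max_corr_bound:
  assumes "1 \<le> d" "\<And>s t. s \<in> S \<Longrightarrow> t \<in> T \<Longrightarrow> int d \<le> \<bar>s - t\<bar>"
  shows "0 \<le> max_corr M (sigma_gen M X S) (sigma_gen M X T)"
    and "max_corr M (sigma_gen M X S) (sigma_gen M X T) \<le> 2 * sqrt (a ^ d / (1 - a))"
proof -
  let ?C = "{\<bar>corr M f g\<bar> | f g. f \<in> borel_measurable (sigma_gen M X S) \<and> square_integrable M f \<and>
     g \<in> borel_measurable (sigma_gen M X T) \<and> square_integrable M g}"
  have bound: "x \<le> 2 * sqrt (a ^ d / (1 - a))" if "x \<in> ?C" for x
    using that corr_bound[OF assms] by auto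
  have z: "\<bar>corr M (\<lambda>_. 0) (\<lambda>_. 0)\<bar> \<in> ?C"
    by (rule CollectI) (intro exI conjI refl, auto intro: square_integrable_const)
  have "\<bar>corr M (\<lambda>_. 0) (\<lambda>_. 0)\<bar> \<le> Sup ?C"
    using z bound by (intro cSup_upper) (auto simp: bdd_above_def)
  then show "0 \<le> max_corr M (sigma_gen M X S) (sigma_gen M X T)"
    unfolding max_corr_def by (meson abs_ge_zero order_trans)
  show "max_corr M (sigma_gen M X S) (sigma_gen M X T) \<le> 2 * sqrt (a ^ d / (1 - a))"
    unfolding max_corr_def using z by (intro cSup_least bound) blast+
qed

lemma rho_star_bound:
  assumes n: "1 \<le> n"
  shows "0 \<le> rho_star M X n" and "rho_star M X n \<le> 2 * sqrt (a ^ n / (1 - a))"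
proof -
  let ?R = "{max_corr M (sigma_gen M X S) (sigma_gen M X T) | S T.
     S \<noteq> {} \<and> T \<noteq> {} \<and> S \<inter> T = {} \<and> n \<le> int_set_dist S T}"
  have range: "0 \<le> x \<and> x \<le> 2 * sqrt (a ^ n / (1 - a))" if x: "x \<in> ?R" for x
  proof -
    obtain S T where ST: "x = max_corr M (sigma_gen M X S) (sigma_gen M X T)" "n \<le> int_set_dist S T"
      using x by auto
    have "int n \<le> \<bar>s - t\<bar>" if "s \<in> S" "t \<in> T" for s t
    proof -
      have "int_set_dist S T \<le> nat \<bar>s - t\<bar>"
        unfolding int_set_dist_def using that by (intro cInf_lower) auto
      then show ?thesis using ST(2) by linarith
    qed
    from max_corr_bound[OF n this] show ?thesis unfolding ST(1) by blast
  qed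
  have ne: "max_corr M (sigma_gen M X {0}) (sigma_gen M X {int n}) \<in> ?R"
  proof -
    have "int_set_dist {0} {int n} = n" by (simp add: int_set_dist_def)
    then have nd: "({0} :: int set) \<noteq> {} \<and> {int n} \<noteq> {} \<and> {0} \<inter> {int n} = {} \<and> n \<le> int_set_dist {0} {int n}"
      using n by simp
    show ?thesis
      by (rule CollectI, rule exI[of _ "{0}"], rule exI[of _ "{int n}"], rule conjI[OF refl nd])
  qed
  have "max_corr M (sigma_gen M X {0}) (sigma_gen M X {int n}) \<le> Sup ?R"
  proof (rule cSup_upper[OF ne])
    show "bdd_above ?R" by (rule bdd_aboveI[of _ "2 * sqrt (a ^ n / (1 - a))"]) (drule range, erule conjunct2)
  qed
  with range[OF ne] show "0 \<le> rho_star M X n"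
    unfolding rho_star_def by (meson order_trans)
  show "rho_star M X n \<le> 2 * sqrt (a ^ n / (1 - a))"
    unfolding rho_star_def
  proof (rule cSup_least)
    show "?R \<noteq> {}" using ne by (metis empty_iff)
    show "x \<le> 2 * sqrt (a ^ n / (1 - a))" if "x \<in> ?R" for x using range[OF that] by (rule conjunct2)
  qed
qed

end

lemma INAR1_Poisson_representation:
  assumes "prob_space M" "0 < a" "a < 1" "0 < l" "INAR1_Poisson M a l X"
  shows "\<exists>U V. poisson_inar M a l X U V"
proof -
  interpret prob_space M by fact
  obtain U V where
    "(\<forall>k. U k \<in> M \<rightarrow>\<^sub>M count_space UNIV \<and> V k \<in> M \<rightarrow>\<^sub>M count_space UNIV)"
    "(\<forall>k. \<forall>\<omega>\<in>space M. X k \<omega> = U k \<omega> + V k \<omega>)"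
    "(\<forall>k x. 0 < measure M {\<omega>\<in>space M. X (k - 1) \<omega> = x} \<longrightarrow>
       distr (uniform_measure M {\<omega>\<in>space M. X (k - 1) \<omega> = x}) (count_space UNIV) (U k) =
         measure_pmf (binomial_pmf x a))"
    "(\<forall>k. markov_triplet M
       (sigma_gen M (\<lambda>j \<omega>. (U j \<omega>, V j \<omega>, X j \<omega>)) {..k - 1})
       (sigma_gen M X {k - 1})
       (sigma_gen M U {k}))"
    "(\<forall>k. distr M (count_space UNIV) (V k) = measure_pmf (poisson_pmf l))"
    "(\<forall>k. indep_set
       (sets (sigma_gen M V {k}))
       (sets (sigma_join M
          (sigma_gen M (\<lambda>j \<omega>. (U j \<omega>, V j \<omega>, X j \<omega>)) {..k - 1})
          (sigma_gen M U {k}))))"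
    using assms(5) unfolding INAR1_Poisson_def by (elim conjE exE)
  then have "poisson_inar M a l X U V"
    using assms unfolding INAR1_Poisson_def by unfold_locales simp_all
  then show ?thesis by blast
qed

theorem theorem1p3:
  fixes M :: "'w measure" and X :: "int \<Rightarrow> 'w \<Rightarrow> nat" and a l :: real
  assumes "prob_space M"
    and "0 < a" and "a < 1" and "0 < l"
    and "INAR1_Poisson M a l X"
  shows "rho_star_mixing M X \<and>
    (\<exists>C r. 0 < C \<and> 0 < r \<and> r < 1 \<and> (\<forall>n\<ge>1. rho_star M X n \<le> C * r ^ n))"
proof -
  obtain U V where "poisson_inar M a l X U V" using INAR1_Poisson_representation[OF assms] by blast
  then interpret poisson_inar M a l X U V .
  define C r where "C = 2 / sqrt (1 - a)" and "r = sqrt a"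
  have C: "0 < C" and r: "0 < r" "r < 1" using a by (auto simp: C_def r_def)
  have bound: "rho_star M X n \<le> C * r ^ n" if "1 \<le> n" for n
    using rho_star_bound(2)[OF that] by (simp add: C_def r_def real_sqrt_divide real_sqrt_power)
  have "rho_star M X \<longlonglongrightarrow> 0"
  proof (rule tendsto_sandwich)
    show "\<forall>\<^sub>F n in sequentially. 0 \<le> rho_star M X n" "\<forall>\<^sub>F n in sequentially. rho_star M X n \<le> C * r ^ n"
      using rho_star_bound(1) bound by (auto intro: eventually_sequentiallyI[of 1])
    show "(\<lambda>n. C * r ^ n) \<longlonglongrightarrow> 0"
      using tendsto_mult[OF tendsto_const[of C] LIMSEQ_power_zero[of r]] r by simp
  qed simp
  then show ?thesis
    unfolding rho_star_mixing_def using C r bound by blast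
qed

end
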